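(* Suppose $\varepsilon>0$ and $f \in H^{\frac{d}{2}+1+\varepsilon}(\mathbb{R}^d)$. Then for any $t \in \mathbb{R}^d$ such that $f(t) \neq 0$ we have $$\frac{1}{2\pi}\nabla \arg f(t) = \frac{\int_{\mathbb{R}^d} \xi\, W_f(t,\xi)\, d\xi}{\int_{\mathbb{R}^d} W_f(t,\xi)\, d\xi}.$$
   Context: Functions are complex-valued. The Fourier transform is $\widehat f(\xi)=\int_{\mathbb{R}^d} f(x)e^{-2\pi i x\cdot\xi}\,dx$, extended to $\mathscr{S}'(\mathbb{R}^d)$ by duality. For $s\in\mathbb{R}$, $H^s(\mathbb{R}^d)$ is the space of $f\in\mathscr{S}'(\mathbb{R}^d)$ with $\widehat f\in L^2_{\rm loc}(\mathbb{R}^d)$ and $\int_{\mathbb{R}^d}\langle\xi\rangle^{2s}|\widehat f(\xi)|^2\,d\xi<\infty$, where $\langle\xi\rangle=(1+|\xi|^2)^{1/2}$. For $s>d/2+1$, elements of $H^s(\mathbb{R}^d)$ are identified with their $C^1$ representatives. The Wigner distribution of $f\in L^2(\mathbb{R}^d)$ is the continuous function $W_f(t,\xi)=\int_{\mathbb{R}^d} f(t+\tau/2)\overline{f(t-\tau/2)}e^{-2\pi i\tau\cdot\xi}\,d\tau$ on $\mathbb{R}^{2d}$. The numerator is the vector $\big(\int_{\mathbb{R}^d}\xi_j W_f(t,\xi)\,d\xi\big)_{j=1}^d$; the integrals are Lebesgue integrals. For $f=u+iv\in C^1(\mathbb{R}^d)$ with $u,v$ real-valued, $\nabla\arg f(t)$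 at a point with $f(t)\neq0$ is the gradient of $\arg f$ computed with a branch of the argument with values in $(-\pi,\pi)$ or in $(0,2\pi)$ (the gradient does not depend on the branch), i.e. $\nabla\arg f(t)=\dfrac{u(t)\nabla v(t)-v(t)\nabla u(t)}{u(t)^2+v(t)^2}$. *)

theory Defs
  imports "HOL-Analysis.Analysis"
begin

section \<open>Differentiability, Schwartz functions, tempered distributions\<close>

definition partial :: "'n::finite \<Rightarrow> (real^'n \<Rightarrow> complex) \<Rightarrow> real^'n \<Rightarrow> complex" where
  "partial i f x = frechet_derivative f (at x) (axis i 1)"

primrec partials :: "'n::finite list \<Rightarrow> (real^'n \<Rightarrow> complex) \<Rightarrow> real^'n \<Rightarrow> complex" where
  "partials [] f = f"
| "partials (i # is) f = partial i (partials is f)"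

definition C1 :: "(real^'n::finite \<Rightarrow> complex) \<Rightarrow> bool" where
  "C1 f \<longleftrightarrow> (\<forall>x. f differentiable (at x)) \<and> (\<forall>i. continuous_on UNIV (partial i f))"

definition smooth :: "(real^'n::finite \<Rightarrow> complex) \<Rightarrow> bool" where
  "smooth f \<longleftrightarrow> (\<forall>is x. partials is f differentiable (at x))"

definition schwartz :: "(real^'n::finite \<Rightarrow> complex) set" where
  "schwartz = {\<phi>. smooth \<phi> \<and>
     (\<forall>N is. bounded (range (\<lambda>x. (1 + norm x) ^ N *\<^sub>R partials is \<phi> x)))}"

text \<open>An increasing family of norms generating the usual Frechet topology of the Schwartz space.
  Multi-indices are represented by the lists of differentiation directions, in any order.\<close>
definition schwartz_norm :: "nat \<Rightarrow> (real^'n::finite \<Rightarrow> complex) \<Rightarrow> real" where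
  "schwartz_norm N \<phi> =
     (\<Sum>is | length is \<le> N. SUP x. (1 + norm x) ^ N * norm (partials is \<phi> x))"

text \<open>A tempered distribution is modelled by a functional on all functions, of which only the
  restriction to \<^const>\<open>schwartz\<close> is meaningful.\<close>
type_synonym 'n distr = "(real^'n \<Rightarrow> complex) \<Rightarrow> complex"

definition tempered :: "'n::finite distr set" where
  "tempered = {T.
     (\<forall>\<phi>\<in>schwartz. \<forall>\<psi>\<in>schwartz. T (\<lambda>x. \<phi> x + \<psi> x) = T \<phi> + T \<psi>) \<and>
     (\<forall>c. \<forall>\<phi>\<in>schwartz. T (\<lambda>x. c * \<phi> x) = c * T \<phi>) \<and>
     (\<exists>C N. \<forall>\<phi>\<in>schwartz. norm (T \<phi>) \<le> C * schwartz_norm N \<phi>)}"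

text \<open>Identification of a function with the distribution \<open>\<phi> \<mapsto> \<integral> g \<phi>\<close>.\<close>
definition represents :: "(real^'n::finite \<Rightarrow> complex) \<Rightarrow> 'n distr \<Rightarrow> bool" where
  "represents g T \<longleftrightarrow> g \<in> borel_measurable lborel \<and>
     (\<forall>\<phi>\<in>schwartz. integrable lborel (\<lambda>x. g x * \<phi> x) \<and> T \<phi> = (LINT x|lborel. g x * \<phi> x))"


section \<open>Fourier transform and Sobolev spaces\<close>

definition fourier :: "(real^'n::finite \<Rightarrow> complex) \<Rightarrow> real^'n \<Rightarrow> complex" where
  "fourier f \<xi> = (LINT x|lborel. f x * exp (- 2 * of_real pi * \<i> * of_real (x \<bullet> \<xi>)))"

definition fourier_distr :: "'n::finite distr \<Rightarrow> 'n distr" where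
  "fourier_distr T = (\<lambda>\<phi>. T (fourier \<phi>))"

definition L2_loc :: "(real^'n::finite \<Rightarrow> complex) set" where
  "L2_loc = {g. g \<in> borel_measurable lborel \<and>
     (\<forall>K. compact K \<longrightarrow> set_integrable lborel K (\<lambda>x. (norm (g x))\<^sup>2))}"

definition bracket :: "real^'n::finite \<Rightarrow> real" where
  "bracket \<xi> = sqrt (1 + (norm \<xi>)\<^sup>2)"

definition sobolev :: "real \<Rightarrow> 'n::finite distr set" where
  "sobolev s = {T \<in> tempered. \<exists>g\<in>L2_loc. represents g (fourier_distr T) \<and>
     integrable lborel (\<lambda>\<xi>. bracket \<xi> powr (2 * s) * (norm (g \<xi>))\<^sup>2)}"


section \<open>Wigner distribution\<close>

definition wigner :: "(real^'n::finite \<Rightarrow> complex) \<Rightarrow> real^'n \<Rightarrow> real^'n \<Rightarrow> complex" where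
  "wigner f t \<xi> = (LINT \<tau>|lborel. f (t + \<tau> /\<^sub>R 2) * cnj (f (t - \<tau> /\<^sub>R 2))
     * exp (- 2 * of_real pi * \<i> * of_real (\<tau> \<bullet> \<xi>)))"


section \<open>Gradient of the argument\<close>

definition gradient :: "('a::real_inner \<Rightarrow> real) \<Rightarrow> 'a \<Rightarrow> 'a" where
  "gradient h t = (THE D. GDERIV h t :> D)"

text \<open>On the complement of the nonpositive reals \<^const>\<open>Arg\<close> is the continuous branch
  with values in \<open>(-\<pi>, \<pi>)\<close>; on the complement of the nonnegative reals \<^const>\<open>Arg2pi\<close> is the
  continuous branch with values in \<open>(0, 2\<pi>)\<close>.  The lemmas below show that the choice is
  immaterial where both apply, and give the explicit formula.\<close>
definition grad_arg :: "('a::real_inner \<Rightarrow> complex) \<Rightarrow> 'a \<Rightarrow> 'a" where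
  "grad_arg f t = (if f t \<notin> \<real>\<^sub>\<le>\<^sub>0 then gradient (\<lambda>x. Arg (f x)) t
                   else gradient (\<lambda>x. Arg2pi (f x)) t)"

lemma gradient_eq: "gradient h t = D" if "GDERIV h t :> D"
proof -
  have "E = D" if "GDERIV h t :> E" for E
  proof -
    have "(\<lambda>k. k \<bullet> E) = (\<lambda>k. k \<bullet> D)"
      using that \<open>GDERIV h t :> D\<close> has_derivative_unique unfolding gderiv_def by blast
    then show ?thesis by (metis vector_eq_ldot)
  qed
  with that show ?thesis unfolding gradient_def by blast
qed

lemma has_derivative_Im_Ln:
  fixes f :: "'a::real_inner \<Rightarrow> complex"
  assumes u: "GDERIV (\<lambda>x. Re (f x)) t :> du" and v: "GDERIV (\<lambda>x. Im (f x)) t :> dv"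
    and z: "f t \<notin> \<real>\<^sub>\<le>\<^sub>0"
  shows "GDERIV (\<lambda>x. Im (Ln (f x))) t :>
    (Re (f t) *\<^sub>R dv - Im (f t) *\<^sub>R du) /\<^sub>R ((Re (f t))\<^sup>2 + (Im (f t))\<^sup>2)"
proof -
  have "((\<lambda>x. Complex (Re (f x)) (Im (f x))) has_derivative
      (\<lambda>h. Complex (h \<bullet> du) (h \<bullet> dv))) (at t)"
    unfolding Complex_eq
    by (intro derivative_intros u[unfolded gderiv_def] v[unfolded gderiv_def])
  then have f: "(f has_derivative (\<lambda>h. Complex (h \<bullet> du) (h \<bullet> dv))) (at t)" by simp
  have "((\<lambda>x. Ln (f x)) has_derivative (\<lambda>h. inverse (f t) * Complex (h \<bullet> du) (h \<bullet> dv))) (at t)"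
    using has_derivative_compose[OF f has_field_derivative_Ln[OF z, unfolded has_field_derivative_def]]
    by simp
  then have "((\<lambda>x. Im (Ln (f x))) has_derivative
      (\<lambda>h. Im (inverse (f t) * Complex (h \<bullet> du) (h \<bullet> dv)))) (at t)"
    by (rule bounded_linear.has_derivative[OF bounded_linear_Im])
  moreover have "Im (inverse (f t) * Complex (h \<bullet> du) (h \<bullet> dv)) =
      h \<bullet> ((Re (f t) *\<^sub>R dv - Im (f t) *\<^sub>R du) /\<^sub>R ((Re (f t))\<^sup>2 + (Im (f t))\<^sup>2))" for h
    by (simp add: inner_diff_right divide_inverse algebra_simps)
  ultimately show ?thesis unfolding gderiv_def by simp
qed

lemma gderiv_transform:
  assumes "GDERIV g t :> D" "eventually (\<lambda>x. g x = h x) (nhds t)"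
  shows "GDERIV h t :> D"
proof -
  have "g t = h t" using assms(2) by (rule eventually_nhds_x_imp_x)
  moreover have "eventually (\<lambda>x. g x = h x) (at t)"
    using assms(2) by (auto simp: eventually_at_filter elim: eventually_mono)
  ultimately show ?thesis using assms(1) unfolding gderiv_def
    by (auto intro: has_derivative_transform_eventually)
qed

lemma
  fixes f :: "'a::real_inner \<Rightarrow> complex"
  assumes u: "GDERIV (\<lambda>x. Re (f x)) t :> du" and v: "GDERIV (\<lambda>x. Im (f x)) t :> dv"
  defines "D \<equiv> (Re (f t) *\<^sub>R dv - Im (f t) *\<^sub>R du) /\<^sub>R ((Re (f t))\<^sup>2 + (Im (f t))\<^sup>2)"
  shows gderiv_Arg: "f t \<notin> \<real>\<^sub>\<le>\<^sub>0 \<Longrightarrow> GDERIV (\<lambda>x. Arg (f x)) t :> D"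
    and gderiv_Arg2pi: "f t \<notin> \<real>\<^sub>\<ge>\<^sub>0 \<Longrightarrow> GDERIV (\<lambda>x. Arg2pi (f x)) t :> D"
    and grad_arg_eq: "f t \<noteq> 0 \<Longrightarrow> grad_arg f t = D"
proof -
  have "isCont (\<lambda>x. Complex (Re (f x)) (Im (f x))) t"
    unfolding Complex_eq using u v
    by (intro continuous_intros) (auto simp: gderiv_def intro: has_derivative_continuous)
  then have cont: "(f \<longlongrightarrow> f t) (nhds t)" by (simp add: isCont_def tendsto_nhds_iff)
  show 1: "GDERIV (\<lambda>x. Arg (f x)) t :> D" if z: "f t \<notin> \<real>\<^sub>\<le>\<^sub>0"
  proof (rule gderiv_transform)
    show "GDERIV (\<lambda>x. Im (Ln (f x))) t :> D"
      unfolding D_def by (rule has_derivative_Im_Ln[OF u v z])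
    have "f t \<in> - {0}" using z by auto
    then have "eventually (\<lambda>x. f x \<in> - {0}) (nhds t)"
      using topological_tendstoD[OF cont] by blast
    then show "eventually (\<lambda>x. Im (Ln (f x)) = Arg (f x)) (nhds t)"
      by eventually_elim (simp add: Arg_eq_Im_Ln)
  qed
  show 2: "GDERIV (\<lambda>x. Arg2pi (f x)) t :> D" if z: "f t \<notin> \<real>\<^sub>\<ge>\<^sub>0"
  proof (rule gderiv_transform)
    have u': "GDERIV (\<lambda>x. Re (- f x)) t :> - du" and v': "GDERIV (\<lambda>x. Im (- f x)) t :> - dv"
      using u v by (auto intro!: GDERIV_minus)
    have z': "- f t \<notin> \<real>\<^sub>\<le>\<^sub>0" using z by (simp add: complex_nonpos_Reals_iff complex_nonneg_Reals_iff)
    have "GDERIV (\<lambda>x. Im (Ln (- f x)) + pi) t :> D + 0"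
      using has_derivative_Im_Ln[OF u' v' z']
      by (intro GDERIV_add GDERIV_const) (simp add: D_def)
    then show "GDERIV (\<lambda>x. Im (Ln (- f x)) + pi) t :> D" by simp
    have "f t \<in> - \<real>\<^sub>\<ge>\<^sub>0" "open (- \<real>\<^sub>\<ge>\<^sub>0 :: complex set)" using z by auto
    then have "eventually (\<lambda>x. f x \<in> - \<real>\<^sub>\<ge>\<^sub>0) (nhds t)"
      using topological_tendstoD[OF cont] by blast
    then show "eventually (\<lambda>x. Im (Ln (- f x)) + pi = Arg2pi (f x)) (nhds t)"
    proof eventually_elim
      case (elim x)
      then have "Arg2pi (f x) \<noteq> 0"
        by (auto simp: Arg2pi_eq_0 complex_nonneg_Reals_iff complex_is_Real_iff)
      then have "0 < Arg2pi (f x)" using Arg2pi_ge_0[of "f x"] by linarith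
      then show ?case by (rule Arg2pi_Ln[symmetric])
    qed
  qed
  show "grad_arg f t = D" if "f t \<noteq> 0"
  proof (cases "f t \<in> \<real>\<^sub>\<le>\<^sub>0")
    case True
    then have "f t \<notin> \<real>\<^sub>\<ge>\<^sub>0" using that
      by (auto simp: complex_nonpos_Reals_iff complex_nonneg_Reals_iff complex_eq_iff)
    from gradient_eq[OF 2[OF this]] True show ?thesis by (simp add: grad_arg_def)
  next
    case False
    from gradient_eq[OF 1[OF False]] False show ?thesis by (simp add: grad_arg_def)
  qed
qed

end

(* Put h(tau) = f(t + tau/2) cnj (f(t - tau/2)), so that wigner f t is the Fourier transform W of h.
   Since the Fourier transform g of f satisfies (1 + |xi|) g in L^1 and g in L^2, f is the inverse
   Fourier transform of g, f is in L^2 and h is in L^1, and h is an absolutely convergent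
   superposition of the oscillations with frequencies (a + b)/2, weighted by g(a) cnj (g(b)).
   This forces (1 + |xi|) W in L^1, so Fourier inversion gives h(tau) = int W(xi) exp(2 pi i tau.xi) d xi,
   which may be differentiated under the integral. At tau = 0 the value is |f(t)|^2 = int W, and the
   gradient is 2 pi i int xi W = i Im (cnj f(t) grad f(t)) = i |f(t)|^2 grad arg f(t). *)
theory Submission
  imports Defs "HOL-Probability.Characteristic_Functions" "HOL-Real_Asymp.Real_Asymp"
begin

section \<open>Oscillations and Gaussians\<close>

text \<open>The exponent enters through \<open>2 * s - 2 > d\<close>: then
  \<open>bracket \<xi> powr (- (2 * s - 2))\<close> is integrable, and the inequality of arithmetic
  and geometric means yields the weighted L^1 bound on g. The extra 1 in the exponent pays for the
  weight, hence for the first moment. That bound only makes f bounded, while the Wigner integral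
  needs h in L^1; hence the detour through L^2 and a Plancherel bound. The obstacle is W:
  integrability of h says nothing about that of W, and h is given as the transform of a product
  measure pushed forward to the midpoints, not visibly of a function. One device serves throughout:
  insert the factor exp(-pi |x|^2 / m^2), whose transform is the unit-mass kernel
  \<open>kern m\<close>, exchange the integrals, let m grow. It identifies f (so that the only test
  functions ever used are Gaussians), bounds f in L^2, bounds W, and inverts the transform.
  Differentiability of h at 0 comes from that of f, so differentiation under the integral only has
  to identify a limit along the steps 1/(n+1).\<close>

lemma
  fixes f :: "'a::euclidean_space \<Rightarrow> real \<Rightarrow> 'b::{real_normed_field,banach,second_countable_topology}"
  assumes "\<And>b. b \<in> Basis \<Longrightarrow> integrable lborel (f b)"
  shows integrable_prod_Basis: "integrable lborel (\<lambda>x. \<Prod>b\<in>Basis. f b (x \<bullet> b))"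
    and integral_prod_Basis:
      "(LINT x|lborel. (\<Prod>b\<in>Basis. f b (x \<bullet> b))) = (\<Prod>b\<in>Basis. integral\<^sup>L lborel (f b))"
proof -
  interpret product_sigma_finite "\<lambda>_::'a. lborel :: real measure"
    by standard
  have [measurable]: "f b \<in> borel_measurable borel" if "b \<in> Basis" for b
    using borel_measurable_integrable[OF assms[OF that]] by simp
  have m1: "(\<lambda>g. \<Sum>b\<in>Basis. g b *\<^sub>R b) \<in> measurable (\<Pi>\<^sub>M b\<in>Basis. lborel) (borel :: 'a measure)"
    by measurable
  have m2: "(\<lambda>x::'a. \<Prod>b\<in>Basis. f b (x \<bullet> b)) \<in> borel_measurable borel"
    by (intro borel_measurable_prod) measurable
  have eq: "(\<Prod>b\<in>Basis. f b ((\<Sum>b\<in>Basis. g b *\<^sub>R b) \<bullet> b)) = (\<Prod>b\<in>Basis. f b (g b))" for g :: "'a \<Rightarrow> real"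
    by (intro prod.cong refl) (simp add: inner_sum_left inner_Basis if_distrib cong: if_cong)
  show "integrable lborel (\<lambda>x. \<Prod>b\<in>Basis. f b (x \<bullet> b))"
    unfolding lborel_eq[where 'a='a]
    by (subst integrable_distr_eq[OF m1 m2]) (simp add: eq product_integrable_prod assms)
  show "(LINT x|lborel. (\<Prod>b\<in>Basis. f b (x \<bullet> b))) = (\<Prod>b\<in>Basis. integral\<^sup>L lborel (f b))"
    unfolding lborel_eq[where 'a='a]
    by (subst integral_distr[OF m1 m2]) (simp add: eq product_integral_prod assms)
qed

text \<open>The sign is that of the inverse transform; the forward kernel is
  \<open>osc x (- \<xi>)\<close>, see \<open>osc_eq_exp\<close>.\<close>

definition osc :: "'a::real_inner \<Rightarrow> 'a \<Rightarrow> complex" where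
  "osc x \<xi> = cis (2 * pi * (x \<bullet> \<xi>))"

lemma norm_osc [simp]: "norm (osc x \<xi>) = 1"
  by (simp add: osc_def)

lemma osc_zero [simp]: "osc 0 \<xi> = 1" "osc x 0 = 1"
  by (simp_all add: osc_def)

lemma cnj_osc: "cnj (osc x \<xi>) = osc x (- \<xi>)"
  by (simp add: osc_def cis_cnj)

lemma osc_minus_left: "osc (- x) \<xi> = osc x (- \<xi>)"
  by (simp add: osc_def)

lemma osc_commute: "osc x \<xi> = osc \<xi> x"
  by (simp add: osc_def inner_commute)

lemma osc_add_left: "osc (x + y) \<xi> = osc x \<xi> * osc y \<xi>"
  and osc_add_right: "osc x (\<xi> + \<eta>) = osc x \<xi> * osc x \<eta>"
  by (simp_all add: osc_def cis_mult algebra_simps inner_add_left inner_add_right)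

lemma osc_eq_exp: "osc x (- \<xi>) = exp (- 2 * of_real pi * \<i> * of_real (x \<bullet> \<xi>))"
  by (simp add: osc_def cis_conv_exp mult_ac)

lemma continuous_on_cis' [continuous_intros]:
  "continuous_on S f \<Longrightarrow> continuous_on S (\<lambda>x. cis (f x))"
  unfolding cis_conv_exp by (intro continuous_intros)

lemma osc_measurable [measurable (raw)]:
  fixes f g :: "'a \<Rightarrow> 'b::euclidean_space"
  assumes [measurable]: "f \<in> borel_measurable M" "g \<in> borel_measurable M"
  shows "(\<lambda>x. osc (f x) (g x)) \<in> borel_measurable M"
proof -
  have [measurable]: "cis \<in> borel_measurable borel"
    by (intro borel_measurable_continuous_onI continuous_intros)
  show ?thesis unfolding osc_def by measurable
qed

text \<open>With pi in the exponent, the transform of \<open>gauss c\<close> is a multiple of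
  \<open>gauss (1 / c)\<close>.\<close>

definition gauss :: "real \<Rightarrow> 'a::euclidean_space \<Rightarrow> real" where
  "gauss c x = exp (- pi * c * (norm x)\<^sup>2)"

lemma gauss_nonneg [simp]: "gauss c x \<ge> 0"
  by (simp add: gauss_def)

lemma gauss_le_1: "c \<ge> 0 \<Longrightarrow> gauss c x \<le> 1"
  by (simp add: gauss_def)

lemma gauss_minus [simp]: "gauss c (- x) = gauss c x"
  by (simp add: gauss_def)

lemma continuous_gauss [continuous_intros]:
  "continuous_on S f \<Longrightarrow> continuous_on S (\<lambda>x. gauss c (f x))"
  unfolding gauss_def by (intro continuous_intros)

lemma gauss_measurable [measurable]: "gauss c \<in> borel_measurable borel"
  by (intro borel_measurable_continuous_onI continuous_intros)

lemma
  fixes c \<eta> :: real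
  assumes c: "c > 0"
  shows integrable_gauss_real: "integrable lborel (\<lambda>x. of_real (exp (- pi * c * x\<^sup>2)) * cis (- 2 * pi * x * \<eta>))"
    and integral_gauss_real: "(LINT x|lborel. of_real (exp (- pi * c * x\<^sup>2)) * cis (- 2 * pi * x * \<eta>))
      = of_real (1 / sqrt c * exp (- pi * (1 / c) * \<eta>\<^sup>2))"
proof -
  \<comment> \<open>\<open>s\<close> and \<open>t\<close> rescale the characteristic function of the
    standard normal law: (s y)^2 / 2 = pi c y^2 and t (s y) = -2 pi y \<eta>.\<close>
  define s where "s = sqrt (2 * pi * c)"
  have s: "s > 0" and s2: "s\<^sup>2 = 2 * pi * c" using c by (simp_all add: s_def)
  define t where "t = - 2 * pi * \<eta> / s"
  let ?F = "\<lambda>x::real. std_normal_density x *\<^sub>R iexp (t * x)"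
  have int: "integrable lborel ?F"
  proof (rule Bochner_Integration.integrable_bound)
    show "integrable lborel std_normal_density"
      using integrable_std_normal_moment[of 0] by simp
    show "AE x in lborel. norm (?F x) \<le> norm (std_normal_density x)"
      by simp
  qed measurable
  have F: "(LINT x|lborel. ?F x) = of_real (exp (- (t\<^sup>2) / 2))"
    using fun_cong[OF char_std_normal_distribution, of t] unfolding char_def
    by (subst (asm) integral_density) (auto simp: normal_density_nonneg)
  have key: "?F (s * y) = (1 / sqrt (2 * pi)) *\<^sub>R (of_real (exp (- pi * c * y\<^sup>2)) * cis (- 2 * pi * y * \<eta>))" for y
  proof -
    have "(s * y)\<^sup>2 / 2 = pi * c * y\<^sup>2" using s2 by (simp add: power_mult_distrib)
    moreover have "t * (s * y) = - 2 * pi * y * \<eta>" using s by (simp add: t_def)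
    ultimately show ?thesis
      unfolding std_normal_density_def cis_conv_exp by (simp add: scaleR_conv_of_real)
  qed
  have i2: "integrable lborel (\<lambda>y. ?F (0 + s * y))"
    using int s by (subst lborel_integrable_real_affine_iff) auto
  then have "integrable lborel (\<lambda>y. sqrt (2 * pi) *\<^sub>R ?F (0 + s * y))"
    by (intro integrable_scaleR_right) auto
  then show "integrable lborel (\<lambda>x. of_real (exp (- pi * c * x\<^sup>2)) * cis (- 2 * pi * x * \<eta>))"
    unfolding add_0_left key by simp
  have "of_real (exp (- (t\<^sup>2) / 2)) = s *\<^sub>R (LINT y|lborel. ?F (0 + s * y))"
    using lborel_integral_real_affine[of s ?F 0] s F by simp
  also have "\<dots> = of_real (s / sqrt (2 * pi)) * (LINT y|lborel. of_real (exp (- pi * c * y\<^sup>2)) * cis (- 2 * pi * y * \<eta>))"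
    unfolding add_0_left key by (simp add: scaleR_conv_of_real)
  also have "s / sqrt (2 * pi) = sqrt c" using c by (simp add: s_def real_sqrt_mult)
  finally have *: "of_real (exp (- (t\<^sup>2) / 2)) = of_real (sqrt c) * (LINT y|lborel. of_real (exp (- pi * c * y\<^sup>2)) * cis (- 2 * pi * y * \<eta>))" .
  have "t\<^sup>2 / 2 = pi * (1 / c) * \<eta>\<^sup>2"
    using c by (simp add: t_def power_divide s2 power_mult_distrib) (simp add: power2_eq_square)
  with * c show "(LINT x|lborel. of_real (exp (- pi * c * x\<^sup>2)) * cis (- 2 * pi * x * \<eta>))
      = of_real (1 / sqrt c * exp (- pi * (1 / c) * \<eta>\<^sup>2))"
    by (simp add: field_simps)
qed

text \<open>Both the Gaussian and the oscillation factor over the coordinates, which reduces the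
  claim to the real line.\<close>

lemma
  fixes \<xi> :: "'a::euclidean_space"
  assumes c: "c > 0"
  shows integrable_gauss_osc: "integrable lborel (\<lambda>x. of_real (gauss c x) * osc x (- \<xi>))"
    and fourier_gauss: "(LINT x|lborel. of_real (gauss c x) * osc x (- \<xi>))
      = of_real ((1 / sqrt c) ^ DIM('a) * gauss (1 / c) \<xi>)"
proof -
  let ?f = "\<lambda>b x. of_real (exp (- pi * c * x\<^sup>2)) * cis (- 2 * pi * x * (\<xi> \<bullet> b)) :: complex"
  have nrm: "(norm z)\<^sup>2 = (\<Sum>b\<in>Basis. (z \<bullet> b)\<^sup>2)" for z :: 'a
    unfolding power2_norm_eq_inner euclidean_inner[of z z] by (simp add: power2_eq_square)
  have g: "gauss r z = (\<Prod>b\<in>Basis. exp (- pi * r * (z \<bullet> b)\<^sup>2))" for r and z :: 'a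
    by (simp add: gauss_def nrm sum_distrib_left sum_negf exp_sum flip: sum_negf)
  have "osc x (- \<xi>) = (\<Prod>b\<in>Basis. cis (- 2 * pi * (x \<bullet> b) * (\<xi> \<bullet> b)))" for x :: 'a
    unfolding osc_def cis_conv_exp
    by (subst exp_sum[symmetric], simp, subst euclidean_inner)
      (simp add: sum_distrib_left sum_negf mult_ac)
  then have eq: "of_real (gauss c x) * osc x (- \<xi>) = (\<Prod>b\<in>Basis. ?f b (x \<bullet> b))" for x
    by (simp add: g prod.distrib)
  show "integrable lborel (\<lambda>x. of_real (gauss c x) * osc x (- \<xi>))"
    unfolding eq by (intro integrable_prod_Basis integrable_gauss_real c)
  show "(LINT x|lborel. of_real (gauss c x) * osc x (- \<xi>))
      = of_real ((1 / sqrt c) ^ DIM('a) * gauss (1 / c) \<xi>)"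
    unfolding eq
    by (subst integral_prod_Basis[OF integrable_gauss_real[OF c]], subst integral_gauss_real[OF c])
      (simp add: g prod_dividef power_one_over)
qed

lemma
  assumes "c > 0"
  shows integrable_gauss: "integrable lborel (gauss c :: 'a::euclidean_space \<Rightarrow> real)"
    and integral_gauss: "(LINT x::'a|lborel. gauss c x) = (1 / sqrt c) ^ DIM('a)"
proof -
  have "integrable lborel (\<lambda>x::'a. Re (of_real (gauss c x)))"
    using integrable_gauss_osc[OF assms, of "0::'a"] by (intro integrable_Re) simp
  then show "integrable lborel (gauss c :: 'a \<Rightarrow> real)" by simp
  have "complex_of_real (LINT x::'a|lborel. gauss c x) = of_real ((1 / sqrt c) ^ DIM('a))"
    using fourier_gauss[OF assms, of "0::'a"] by (simp add: gauss_def)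
  then show "(LINT x::'a|lborel. gauss c x) = (1 / sqrt c) ^ DIM('a)"
    using of_real_eq_iff by blast
qed

section \<open>Gaussians are Schwartz functions\<close>

text \<open>Polynomials with complex coefficients. Functions p exp(q) with polynomial p and q are
  closed under partial derivatives, so a single growth estimate covers every iterated partial of a
  Gaussian.\<close>

inductive cpoly :: "(real^'n::finite \<Rightarrow> complex) \<Rightarrow> bool" where
  cpoly_const: "cpoly (\<lambda>_. c)"
| cpoly_coord: "cpoly (\<lambda>x. of_real (x $ i))"
| cpoly_add: "cpoly p \<Longrightarrow> cpoly q \<Longrightarrow> cpoly (\<lambda>x. p x + q x)"
| cpoly_mult: "cpoly p \<Longrightarrow> cpoly q \<Longrightarrow> cpoly (\<lambda>x. p x * q x)"

lemma cpoly_sum: "(\<And>i. i \<in> I \<Longrightarrow> cpoly (p i)) \<Longrightarrow> cpoly (\<lambda>x. \<Sum>i\<in>I. p i x)"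
  by (induction I rule: infinite_finite_induct) (auto intro: cpoly.intros)

lemma partialI: "(f has_derivative D) (at x) \<Longrightarrow> partial i f x = D (axis i 1)"
  unfolding partial_def by (metis frechet_derivative_at)

lemma has_derivative_partial:
  "f differentiable (at x) \<Longrightarrow> (f has_derivative frechet_derivative f (at x)) (at x)"
  by (simp add: frechet_derivative_works)

lemma partial_add:
  assumes "f differentiable (at x)" "g differentiable (at x)"
  shows "partial i (\<lambda>x. f x + g x) x = partial i f x + partial i g x"
  by (subst partialI[OF has_derivative_add[OF assms[THEN has_derivative_partial]]]) (simp add: partial_def)

lemma partial_mult:
  assumes "f differentiable (at x)" "g differentiable (at x)"
  shows "partial i (\<lambda>x. f x * g x) x = f x * partial i g x + partial i f x * g x"
  by (subst partialI[OF has_derivative_mult[OF assms[THEN has_derivative_partial]]]) (simp add: partial_def)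

lemma cpoly_differentiable: "cpoly p \<Longrightarrow> p differentiable (at x)"
proof (induction rule: cpoly.induct)
  case (cpoly_coord i)
  have "bounded_linear (\<lambda>x::real^'a. complex_of_real (x $ i))"
    by (intro bounded_linear_compose[OF bounded_linear_of_real] bounded_linear_vec_nth)
  then show ?case
    using bounded_linear_imp_has_derivative differentiableI by blast
qed auto

lemma cpoly_partial: "cpoly p \<Longrightarrow> cpoly (partial i p)"
proof (induction rule: cpoly.induct)
  case (cpoly_const c)
  have "partial i (\<lambda>_. c) = (\<lambda>_. 0)" by (intro ext) (simp add: partialI[OF has_derivative_const])
  then show ?case by (simp add: cpoly.cpoly_const)
next
  case (cpoly_coord j)
  have "bounded_linear (\<lambda>x::real^'a. complex_of_real (x $ j))"
    by (intro bounded_linear_compose[OF bounded_linear_of_real] bounded_linear_vec_nth)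
  then have "partial i (\<lambda>x. of_real (x $ j)) = (\<lambda>_. of_real (axis i 1 $ j))"
    by (intro ext) (rule partialI[OF bounded_linear_imp_has_derivative])
  then show ?case by (simp add: cpoly.cpoly_const)
next
  case (cpoly_add p q)
  then have "partial i (\<lambda>x. p x + q x) = (\<lambda>x. partial i p x + partial i q x)"
    by (intro ext partial_add cpoly_differentiable)
  with cpoly_add show ?case by (simp add: cpoly.cpoly_add)
next
  case (cpoly_mult p q)
  then have "partial i (\<lambda>x. p x * q x) = (\<lambda>x. p x * partial i q x + partial i p x * q x)"
    by (intro ext partial_mult cpoly_differentiable)
  with cpoly_mult show ?case by (simp add: cpoly.cpoly_add cpoly.cpoly_mult)
qed

lemma cpoly_exp_partial:
  assumes "cpoly p" "cpoly q"
  shows "partial i (\<lambda>x. p x * exp (q x)) = (\<lambda>x. (partial i p x + p x * partial i q x) * exp (q x))"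
    and "(\<lambda>x. p x * exp (q x)) differentiable (at x)"
proof -
  have "((\<lambda>x. p x * exp (q x)) has_derivative
      (\<lambda>h. p x * (exp (q x) * frechet_derivative q (at x) h) + frechet_derivative p (at x) h * exp (q x))) (at x)" for x
    by (intro has_derivative_mult has_derivative_partial cpoly_differentiable assms
        has_derivative_compose[OF has_derivative_partial[OF cpoly_differentiable[OF assms(2)]]]
        DERIV_exp[unfolded has_field_derivative_def])
  note D = this
  show "(\<lambda>x. p x * exp (q x)) differentiable (at x)" using D differentiableI by blast
  show "partial i (\<lambda>x. p x * exp (q x)) = (\<lambda>x. (partial i p x + p x * partial i q x) * exp (q x))"
    by (intro ext, subst partialI[OF D]) (simp add: partial_def algebra_simps)
qed

lemma cpoly_exp_partials:
  assumes "cpoly p" "cpoly q"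
  shows "\<exists>p'. cpoly p' \<and> partials is (\<lambda>x. p x * exp (q x)) = (\<lambda>x. p' x * exp (q x))"
proof (induction "is")
  case (Cons i "is")
  then obtain p' where "cpoly p'" "partials is (\<lambda>x. p x * exp (q x)) = (\<lambda>x. p' x * exp (q x))" by blast
  with assms(2) show ?case
    by (auto simp: cpoly_exp_partial(1) intro!: exI[of _ "\<lambda>x. partial i p' x + p' x * partial i q x"]
        cpoly.intros cpoly_partial)
qed (use assms in auto)

lemma cpoly_growth: "cpoly p \<Longrightarrow> \<exists>C k. C \<ge> 0 \<and> (\<forall>x. norm (p x) \<le> C * (1 + norm x) ^ k)"
proof (induction rule: cpoly.induct)
  case (cpoly_const c)
  show ?case by (intro exI[of _ "norm c"] exI[of _ 0]) auto
next
  case (cpoly_coord i)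
  show ?case
  proof (intro exI[of _ 1] exI[of _ 1] conjI allI)
    fix x :: "real^'a"
    show "norm (complex_of_real (x $ i)) \<le> 1 * (1 + norm x) ^ 1"
      using component_le_norm_cart[of x i] by simp
  qed auto
next
  case (cpoly_add p q)
  then obtain C k D l where C: "C \<ge> 0" "\<And>x. norm (p x) \<le> C * (1 + norm x) ^ k"
    and D: "D \<ge> 0" "\<And>x. norm (q x) \<le> D * (1 + norm x) ^ l" by metis
  have "norm (p x + q x) \<le> (C + D) * (1 + norm x) ^ max k l" for x
  proof -
    have "norm (p x + q x) \<le> C * (1 + norm x) ^ k + D * (1 + norm x) ^ l"
      using C(2)[of x] D(2)[of x] norm_triangle_ineq[of "p x" "q x"] by linarith
    also have "\<dots> \<le> C * (1 + norm x) ^ max k l + D * (1 + norm x) ^ max k l"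
      using C(1) D(1) by (intro add_mono mult_left_mono power_increasing) auto
    finally show ?thesis by (simp add: algebra_simps)
  qed
  with C(1) D(1) show ?case by (intro exI[of _ "C + D"] exI[of _ "max k l"]) auto
next
  case (cpoly_mult p q)
  then obtain C k D l where C: "C \<ge> 0" "\<And>x. norm (p x) \<le> C * (1 + norm x) ^ k"
    and D: "D \<ge> 0" "\<And>x. norm (q x) \<le> D * (1 + norm x) ^ l" by metis
  have "norm (p x * q x) \<le> (C * D) * (1 + norm x) ^ (k + l)" for x
    using mult_mono[OF C(2)[of x] D(2)[of x]] C(1) by (simp add: norm_mult power_add mult_ac)
  with C(1) D(1) show ?case by (intro exI[of _ "C * D"] exI[of _ "k + l"]) auto
qed

text \<open>Quadratic decay of Re q beats any polynomial. The constant \<open>A\<close> leaves room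
  for Gaussians centred away from the origin.\<close>

lemma schwartz_cpoly_exp:
  assumes p: "cpoly p" and q: "cpoly q" and a: "a > 0" and Re: "\<And>x. Re (q x) \<le> A - a * (norm x)\<^sup>2"
  shows "(\<lambda>x. p x * exp (q x)) \<in> schwartz"
proof -
  have "bounded (range (\<lambda>x. (1 + norm x) ^ N *\<^sub>R partials is (\<lambda>x. p x * exp (q x)) x))" for N "is"
  proof -
    obtain p' where p': "cpoly p'" "partials is (\<lambda>x. p x * exp (q x)) = (\<lambda>x. p' x * exp (q x))"
      using cpoly_exp_partials[OF p q] by blast
    obtain C k where C: "C \<ge> 0" "\<And>x. norm (p' x) \<le> C * (1 + norm x) ^ k"
      using cpoly_growth[OF p'(1)] by blast
    define M where "M = N + k"
    have "norm ((1 + norm x) ^ N *\<^sub>R (p' x * exp (q x))) \<le> C * exp (real M ^ 2 / (4 * a) + A)" for x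
    proof -
      let ?r = "norm x"
      \<comment> \<open>Completing the square: M r - a r^2 is at most M^2 / (4 a).\<close>
      have "0 \<le> (2 * a * ?r - real M)\<^sup>2" by simp
      then have "4 * a * (real M * ?r - a * ?r\<^sup>2) \<le> (real M)\<^sup>2"
        by (simp add: power2_eq_square algebra_simps)
      then have quad: "real M * ?r - a * ?r\<^sup>2 \<le> (real M)\<^sup>2 / (4 * a)"
        using a by (simp add: field_simps)
      have "norm ((1 + norm x) ^ N *\<^sub>R (p' x * exp (q x))) = (1 + ?r) ^ N * norm (p' x) * exp (Re (q x))"
        by (simp add: norm_mult)
      also have "\<dots> \<le> (1 + ?r) ^ N * (C * (1 + ?r) ^ k) * exp (A - a * ?r\<^sup>2)"
        using C Re[of x] by (intro mult_mono) auto
      also have "\<dots> = C * ((1 + ?r) ^ M * exp (A - a * ?r\<^sup>2))"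
        by (simp add: M_def power_add mult_ac)
      \<comment> \<open>1 + r \<le> exp r turns the polynomial factor into a linear exponent, to
        which \<open>quad\<close> applies.\<close>
      also have "\<dots> \<le> C * (exp ?r ^ M * exp (A - a * ?r\<^sup>2))"
        using C(1) by (intro mult_left_mono mult_right_mono power_mono) auto
      also have "\<dots> = C * exp (real M * ?r - a * ?r\<^sup>2 + A)"
        by (simp add: exp_of_nat_mult[symmetric] exp_add[symmetric] algebra_simps)
      also have "\<dots> \<le> C * exp (real M ^ 2 / (4 * a) + A)"
        using quad C(1) by (intro mult_left_mono) auto
      finally show ?thesis .
    qed
    then show ?thesis unfolding p'(2) bounded_iff by blast
  qed
  moreover have "smooth (\<lambda>x. p x * exp (q x))"
    unfolding smooth_def
  proof (intro allI)
    fix "is" x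
    show "partials is (\<lambda>x. p x * exp (q x)) differentiable at x"
      using cpoly_exp_partials[OF p q, of "is"] cpoly_exp_partial(2)[OF _ q] by auto
  qed
  ultimately show ?thesis by (simp add: schwartz_def)
qed

lemma cpoly_norm_diff: "cpoly (\<lambda>x. of_real ((norm (x - a))\<^sup>2))"
proof -
  have "complex_of_real ((norm (x - a))\<^sup>2) =
      (\<Sum>i\<in>UNIV. (of_real (x $ i) + - of_real (a $ i)) * (of_real (x $ i) + - of_real (a $ i)))" for x
    unfolding power2_norm_eq_inner inner_vec_def by simp
  then show ?thesis by (simp only:) (intro cpoly_sum cpoly.intros)
qed

lemma cpoly_inner: "cpoly (\<lambda>x. of_real (a \<bullet> x))"
proof -
  have "complex_of_real (a \<bullet> x) = (\<Sum>i\<in>UNIV. of_real (a $ i) * of_real (x $ i))" for x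
    unfolding inner_vec_def by simp
  then show ?thesis by (simp only:) (intro cpoly_sum cpoly.intros)
qed

lemma schwartz_gauss_osc:
  fixes x :: "real^'n::finite"
  assumes "c > 0"
  shows "(\<lambda>\<xi>. of_real (gauss c \<xi>) * osc x \<xi>) \<in> schwartz"
proof -
  let ?q = "\<lambda>\<xi>. of_real (- pi * c) * of_real ((norm (\<xi> - 0))\<^sup>2) + (2 * pi * \<i>) * of_real (x \<bullet> \<xi>)"
  have "(\<lambda>\<xi>. 1 * exp (?q \<xi>)) \<in> schwartz"
    using assms
    by (intro schwartz_cpoly_exp[where a = "pi * c" and A = 0] cpoly.intros cpoly_norm_diff cpoly_inner) auto
  moreover have "1 * exp (?q \<xi>) = of_real (gauss c \<xi>) * osc x \<xi>" for \<xi>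
  proof -
    have "?q \<xi> = of_real (- pi * c * (norm \<xi>)\<^sup>2) + \<i> * of_real (2 * pi * (x \<bullet> \<xi>))" by simp
    then show ?thesis by (simp only: exp_add exp_of_real gauss_def osc_def cis_conv_exp mult_1)
  qed
  ultimately show ?thesis by (simp only:)
qed

lemma schwartz_gauss_shift:
  fixes x :: "real^'n::finite"
  assumes "c > 0"
  shows "(\<lambda>y. of_real (k * gauss c (y - x))) \<in> schwartz"
proof -
  let ?q = "\<lambda>y. of_real (- pi * c) * complex_of_real ((norm (y - x))\<^sup>2)"
  have "(\<lambda>y. of_real k * exp (?q y)) \<in> schwartz"
  \<comment> \<open>From |y|^2 \<le> 2 |y - x|^2 + 2 |x|^2: half of the decay rate survives the
    shift, and the rest is the constant \<open>A\<close>.\<close>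
  proof (intro schwartz_cpoly_exp[where a = "pi * c / 2" and A = "pi * c * (norm x)\<^sup>2"] cpoly.intros cpoly_norm_diff)
    fix y
    have "norm y \<le> norm (y - x) + norm x" by norm
    then have "(norm y)\<^sup>2 \<le> (norm (y - x) + norm x)\<^sup>2" by (intro power_mono) auto
    also have "\<dots> \<le> 2 * (norm (y - x))\<^sup>2 + 2 * (norm x)\<^sup>2"
      using sum_squares_bound[of "norm (y - x)" "norm x"] by (simp add: power2_sum)
    finally have "pi * c / 2 * (norm y)\<^sup>2 \<le> pi * c / 2 * (2 * (norm (y - x))\<^sup>2 + 2 * (norm x)\<^sup>2)"
      using assms by (intro mult_left_mono) auto
    then show "Re (?q y) \<le> pi * c * (norm x)\<^sup>2 - pi * c / 2 * (norm y)\<^sup>2"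
      by (simp add: algebra_simps)
  qed (use assms in auto)
  moreover have "of_real k * exp (?q y) = of_real (k * gauss c (y - x))" for y
    by (simp add: gauss_def exp_of_real[symmetric])
  ultimately show ?thesis by (simp only:)
qed

section \<open>Integrability on the Fourier side\<close>

lemma bracket_ge_1: "bracket \<xi> \<ge> 1" and bracket_pos: "bracket \<xi> > 0"
proof -
  show "bracket \<xi> \<ge> 1" by (simp add: bracket_def)
  then show "bracket \<xi> > 0" by linarith
qed

lemma one_plus_norm_le_bracket: "1 + norm \<xi> \<le> sqrt 2 * bracket \<xi>"
proof -
  have "(1 + norm \<xi>)\<^sup>2 \<le> 2 * (1 + (norm \<xi>)\<^sup>2)"
    using sum_squares_bound[of 1 "norm \<xi>"] by (simp add: power2_eq_square algebra_simps)
  then show ?thesis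
    unfolding bracket_def real_sqrt_mult[symmetric] by (rule real_le_rsqrt)
qed

lemma bracket_measurable [measurable]: "bracket \<in> borel_measurable borel"
  unfolding bracket_def by measurable

text \<open>The half-line integral comes from the explicit antiderivative, the other half from
  reflection. At 0 both halves contribute, so their sum serves as a bound.\<close>

lemma integrable_one_plus_abs_powr:
  fixes r :: real
  assumes "r > 1"
  shows "integrable lborel (\<lambda>x::real. (1 + \<bar>x\<bar>) powr (- r))"
proof -
  let ?h = "\<lambda>x::real. (1 + \<bar>x\<bar>) powr (- r)"
  have "((\<lambda>x. ((1 + x) powr (1 - r)) / (1 - r)) \<longlongrightarrow> 0) at_top"
    using assms by real_asymp
  then have "(\<integral>\<^sup>+x. ennreal (?h x) * indicator {0..} x \<partial>lborel) = ennreal (0 - (1 + 0) powr (1 - r) / (1 - r))"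
    using assms
    by (intro nn_integral_FTC_atLeast) (auto intro!: derivative_eq_intros)
  then have "integrable lborel (\<lambda>x. ?h x * indicator {0..} x)"
    by (intro integrableI_nonneg) (auto simp: ennreal_mult ennreal_indicator)
  then have P: "integrable lborel (\<lambda>x. indicator {0..} x * ?h x)" by (simp add: mult.commute)
  then have N: "integrable lborel (\<lambda>x. indicator {0..} (0 + (-1) * x) * ?h (0 + (-1) * x))"
    by (rule lborel_integrable_real_affine) simp
  show ?thesis
    by (rule Bochner_Integration.integrable_bound[OF Bochner_Integration.integrable_add[OF P N]])
      (auto simp: indicator_def)
qed

text \<open>The exponent is shared equally among the d coordinates. Each gets
  \<open>q = r / d > 1\<close>, and the bracket dominates 1 + |\<xi>_b| up to the factor
  \<open>sqrt 2\<close>, so a product of integrable one-dimensional functions bounds the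
  power.\<close>

lemma integrable_bracket_powr:
  assumes "r > real CARD('n)"
  shows "integrable lborel (\<lambda>\<xi>::real^'n::finite. bracket \<xi> powr (- r))"
proof -
  let ?d = "real CARD('n)"
  define q where "q = r / ?d"
  have q: "q > 1" "?d * q = r" using assms by (simp_all add: q_def)
  have int: "integrable lborel (\<lambda>\<xi>::real^'n. \<Prod>b\<in>Basis. (sqrt 2 powr q * (1 + \<bar>\<xi> \<bullet> b\<bar>) powr (- q)))"
    by (intro integrable_prod_Basis integrable_mult_right integrable_one_plus_abs_powr q)
  show ?thesis
  proof (rule Bochner_Integration.integrable_bound[OF int], measurable, intro AE_I2)
    fix \<xi> :: "real^'n"
    have *: "bracket \<xi> powr (- q) \<le> sqrt 2 powr q * (1 + \<bar>\<xi> \<bullet> b\<bar>) powr (- q)" if "b \<in> Basis" for b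
    proof -
      have "1 + \<bar>\<xi> \<bullet> b\<bar> \<le> sqrt 2 * bracket \<xi>"
        using one_plus_norm_le_bracket[of \<xi>] Basis_le_norm[OF that, of \<xi>] by linarith
      then have "(sqrt 2 * bracket \<xi>) powr (- q) \<le> (1 + \<bar>\<xi> \<bullet> b\<bar>) powr (- q)"
        using q by (intro powr_mono2') auto
      then have "sqrt 2 powr q * (sqrt 2 * bracket \<xi>) powr (- q) \<le> sqrt 2 powr q * (1 + \<bar>\<xi> \<bullet> b\<bar>) powr (- q)"
        by (intro mult_left_mono) auto
      also have "sqrt 2 powr q * (sqrt 2 * bracket \<xi>) powr (- q) = bracket \<xi> powr (- q)"
        using bracket_pos[of \<xi>] by (simp add: powr_mult powr_minus field_simps)
      finally show ?thesis .
    qed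
    have "bracket \<xi> powr (- r) = (\<Prod>b\<in>(Basis :: (real^'n) set). bracket \<xi> powr (- q))"
      using bracket_pos[of \<xi>] q(2) by (simp add: powr_power)
    also have "\<dots> \<le> (\<Prod>b\<in>(Basis :: (real^'n) set). (sqrt 2 powr q * (1 + \<bar>\<xi> \<bullet> b\<bar>) powr (- q)))"
      using * by (intro prod_mono) auto
    finally show "norm (bracket \<xi> powr (- r)) \<le> norm (\<Prod>b\<in>Basis. (sqrt 2 powr q * (1 + \<bar>\<xi> \<bullet> b\<bar>) powr (- q)))"
      by simp
  qed
qed

lemma
  fixes g :: "real^'n::finite \<Rightarrow> complex"
  assumes g[measurable]: "g \<in> borel_measurable borel" and s: "s > real CARD('n) / 2 + 1"
    and int: "integrable lborel (\<lambda>\<xi>. bracket \<xi> powr (2 * s) * (norm (g \<xi>))\<^sup>2)"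
  shows sobolev_integrable_weighted: "integrable lborel (\<lambda>\<xi>. (1 + norm \<xi>) * norm (g \<xi>))"
    and sobolev_integrable_square: "integrable lborel (\<lambda>\<xi>. (norm (g \<xi>))\<^sup>2)"
proof -
  have "integrable lborel (\<lambda>\<xi>::real^'n. bracket \<xi> powr (- (2 * s - 2)))"
    using s by (intro integrable_bracket_powr) simp
  from Bochner_Integration.integrable_add[OF this int]
  show "integrable lborel (\<lambda>\<xi>. (1 + norm \<xi>) * norm (g \<xi>))"
  proof (rule Bochner_Integration.integrable_bound, measurable, intro AE_I2)
    fix \<xi> :: "real^'n"
    let ?b = "bracket \<xi>"
    have b: "?b > 0" by (rule bracket_pos)
    have "(1 + norm \<xi>) * norm (g \<xi>) \<le> sqrt 2 * (?b * norm (g \<xi>))"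
      using mult_right_mono[OF one_plus_norm_le_bracket norm_ge_zero] by (simp add: mult_ac)
    \<comment> \<open>Rounding \<open>sqrt 2\<close> up to 2 prepares 2 x y \<le> x^2 + y^2, with
      bracket powers 1 - s and s in the two factors. The first square is integrable exactly because
      2 s - 2 > d.\<close>
    also have "\<dots> \<le> 2 * (?b * norm (g \<xi>))"
      using b sqrt2_less_2 by (intro mult_right_mono) auto
    also have "?b * norm (g \<xi>) = ?b powr (1 - s) * (?b powr s * norm (g \<xi>))"
      using b by (simp add: mult.assoc[symmetric] powr_add[symmetric])
    also have "2 * \<dots> \<le> (?b powr (1 - s))\<^sup>2 + (?b powr s * norm (g \<xi>))\<^sup>2"
      using sum_squares_bound[of "?b powr (1 - s)" "?b powr s * norm (g \<xi>)"] by (simp add: mult_ac)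
    also have "\<dots> = ?b powr (- (2 * s - 2)) + ?b powr (2 * s) * (norm (g \<xi>))\<^sup>2"
      using b by (simp add: power_mult_distrib powr_power algebra_simps)
    finally show "norm ((1 + norm \<xi>) * norm (g \<xi>))
        \<le> norm (?b powr (- (2 * s - 2)) + ?b powr (2 * s) * (norm (g \<xi>))\<^sup>2)"
      by simp
  qed
  from int show "integrable lborel (\<lambda>\<xi>. (norm (g \<xi>))\<^sup>2)"
  proof (rule Bochner_Integration.integrable_bound, measurable, intro AE_I2)
    fix \<xi> :: "real^'n"
    have "s \<ge> 0" using s by (smt (verit) of_nat_0_le_iff divide_nonneg_nonneg)
    then have "1 \<le> bracket \<xi> powr (2 * s)"
      by (intro ge_one_powr_ge_zero bracket_ge_1) simp
    then show "norm ((norm (g \<xi>))\<^sup>2) \<le> norm (bracket \<xi> powr (2 * s) * (norm (g \<xi>))\<^sup>2)"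
      using mult_right_mono[of 1 "bracket \<xi> powr (2 * s)" "(norm (g \<xi>))\<^sup>2"] by simp
  qed
qed

section \<open>Gaussian approximate identity\<close>

lemma distr_lborel_translate: "distr lborel borel (\<lambda>x. x + c) = (lborel :: 'a::euclidean_space measure)"
proof -
  have "(\<lambda>x. x + c) = (+) c" by (auto simp: add.commute)
  then show ?thesis by (simp add: lborel_distr_plus)
qed

lemma
  fixes f :: "'a::euclidean_space \<Rightarrow> 'b::{banach, second_countable_topology}"
  assumes [measurable]: "f \<in> borel_measurable borel"
  shows integrable_translate_iff: "integrable lborel (\<lambda>x. f (x + c)) \<longleftrightarrow> integrable lborel f"
    and integral_translate: "(LINT x|lborel. f (x + c)) = (LINT x|lborel. f x)"
proof -
  have "integrable (distr lborel borel (\<lambda>x. x + c)) f \<longleftrightarrow> integrable lborel (\<lambda>x. f (x + c))"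
    by (rule integrable_distr_eq) measurable
  then show "integrable lborel (\<lambda>x. f (x + c)) \<longleftrightarrow> integrable lborel f"
    by (simp add: distr_lborel_translate)
  have "integral\<^sup>L (distr lborel borel (\<lambda>x. x + c)) f = (LINT x|lborel. f (x + c))"
    by (rule integral_distr) measurable
  then show "(LINT x|lborel. f (x + c)) = (LINT x|lborel. f x)"
    by (simp add: distr_lborel_translate)
qed

lemma nn_integral_translate:
  fixes f :: "'a::euclidean_space \<Rightarrow> ennreal"
  assumes [measurable]: "f \<in> borel_measurable borel"
  shows "(\<integral>\<^sup>+x. f (x + c) \<partial>lborel) = (\<integral>\<^sup>+x. f x \<partial>lborel)"
proof -
  have "integral\<^sup>N (distr lborel borel (\<lambda>x. x + c)) f = (\<integral>\<^sup>+x. f (x + c) \<partial>lborel)"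
    by (rule nn_integral_distr) measurable
  then show ?thesis by (simp add: distr_lborel_translate)
qed

lemma integrable_affine:
  fixes f :: "'a::euclidean_space \<Rightarrow> 'b::{banach, second_countable_topology}"
  assumes f: "integrable lborel f" and c: "c \<noteq> 0"
  shows "integrable lborel (\<lambda>x. f (t + c *\<^sub>R x))"
proof -
  have [measurable]: "f \<in> borel_measurable borel" using f by auto
  have "integrable (density (distr lborel borel (\<lambda>x. t + c *\<^sub>R x)) (\<lambda>_. ennreal (\<bar>c\<bar> ^ DIM('a)))) f"
    using f lborel_affine[OF c, of t] by simp
  then have "integrable (distr lborel borel (\<lambda>x. t + c *\<^sub>R x)) (\<lambda>x. \<bar>c\<bar> ^ DIM('a) *\<^sub>R f x)"
    by (subst (asm) integrable_density) auto
  from integrable_scaleR_right[OF this, of "inverse (\<bar>c\<bar> ^ DIM('a))"]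
  have "integrable (distr lborel borel (\<lambda>x. t + c *\<^sub>R x)) f"
    using c by simp
  then show ?thesis by (subst (asm) integrable_distr_eq) auto
qed

text \<open>The transform of \<open>gauss (1 / m\<^sup>2)\<close>, see
  \<open>fourier_gauss_kern\<close>: as the Gaussian factor widens towards 1, this kernel of mass 1
  concentrates at 0.\<close>

definition kern :: "real \<Rightarrow> 'a::euclidean_space \<Rightarrow> real" where
  "kern m y = m ^ DIM('a) * gauss (m\<^sup>2) y"

lemma kern_nonneg [simp]: "m > 0 \<Longrightarrow> kern m y \<ge> 0"
  by (simp add: kern_def)

lemma kern_minus [simp]: "kern m (- y) = kern m y"
  by (simp add: kern_def)

lemma kern_measurable [measurable]: "kern m \<in> borel_measurable borel"
  unfolding kern_def by measurable

lemma fourier_gauss_kern: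
  fixes \<xi> :: "'a::euclidean_space"
  assumes "m > 0"
  shows "(LINT x|lborel. of_real (gauss (1 / m\<^sup>2) x) * osc x (- \<xi>)) = of_real (kern m \<xi>)"
  using assms by (subst fourier_gauss) (simp_all add: kern_def real_sqrt_divide)

lemma
  fixes x :: "'a::euclidean_space"
  assumes "m > 0"
  shows integrable_kern: "integrable lborel (\<lambda>y. kern m (y - x))"
    and integral_kern: "(LINT y|lborel. kern m (y - x)) = 1"
proof -
  have g: "integrable lborel (gauss (m\<^sup>2) :: 'a \<Rightarrow> real)" using assms by (intro integrable_gauss) simp
  then have "integrable lborel (kern m :: 'a \<Rightarrow> real)"
    unfolding kern_def by simp
  then show "integrable lborel (\<lambda>y. kern m (y - x))"
    using integrable_translate_iff[of "kern m" "- x"] by simp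
  have "(LINT y::'a|lborel. kern m y) = 1"
    unfolding kern_def using assms integral_gauss[of "m\<^sup>2", where 'a='a] by (simp add: power_one_over)
  then show "(LINT y|lborel. kern m (y - x)) = 1"
    using integral_translate[of "kern m" "- x"] by simp
qed

lemma kern_le_gauss: "m \<ge> 1 \<Longrightarrow> kern m (y::'a::euclidean_space) \<le> m ^ DIM('a) * gauss 1 y"
proof -
  assume m: "m \<ge> 1"
  then have "pi * (1 * (norm y)\<^sup>2) \<le> pi * (m\<^sup>2 * (norm y)\<^sup>2)"
    by (intro mult_left_mono mult_right_mono one_le_power) auto
  with m show ?thesis
    unfolding kern_def gauss_def by (intro mult_left_mono) (auto simp: mult.assoc)
qed

text \<open>One unit of the exponent m^2 is kept as \<open>gauss 1\<close>; the remaining m^2 - 1 is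
  evaluated at radius r and gives a factor that vanishes as m grows.\<close>

lemma kern_le_gauss_away:
  fixes y :: "'a::euclidean_space"
  assumes "m \<ge> 1" "norm y \<ge> r" "r \<ge> 0"
  shows "kern m y \<le> (m ^ DIM('a) * exp (- pi * r\<^sup>2 * (m\<^sup>2 - 1))) * gauss 1 y"
proof -
  have "(m\<^sup>2 - 1) * r\<^sup>2 \<le> (m\<^sup>2 - 1) * (norm y)\<^sup>2"
    using assms by (intro mult_left_mono power_mono) (auto simp: one_le_power)
  then have "pi * ((m\<^sup>2 - 1) * r\<^sup>2) \<le> pi * ((m\<^sup>2 - 1) * (norm y)\<^sup>2)"
    by (rule mult_left_mono) auto
  then have "- pi * m\<^sup>2 * (norm y)\<^sup>2 \<le> - pi * r\<^sup>2 * (m\<^sup>2 - 1) + - pi * 1 * (norm y)\<^sup>2"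
    by (simp add: algebra_simps)
  then have "gauss (m\<^sup>2) y \<le> exp (- pi * r\<^sup>2 * (m\<^sup>2 - 1)) * gauss 1 y"
    unfolding gauss_def exp_add[symmetric] by simp
  then show ?thesis
    unfolding kern_def mult.assoc using assms(1) by (intro mult_left_mono) auto
qed

text \<open>Integrability against one Gaussian suffices: near x continuity controls the error, away
  from x \<open>kern_le_gauss_away\<close> bounds it by a null sequence times a fixed integral. This
  covers an f known only to be integrable against Schwartz functions. The scales
  \<open>real (Suc n)\<close> stay at least 1, as the Gaussian bounds require.\<close>

lemma approx_identity:
  fixes f :: "'a::euclidean_space \<Rightarrow> complex"
  assumes f[measurable]: "f \<in> borel_measurable borel" and cont: "isCont f x"
    and int: "integrable lborel (\<lambda>y. f y * of_real (gauss 1 (y - x)))"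
  shows "(\<lambda>n. LINT y|lborel. f y * of_real (kern (real (Suc n)) (y - x))) \<longlonglongrightarrow> f x"
proof (rule LIMSEQ_I)
  fix e :: real assume e: "e > 0"
  let ?K = "\<lambda>n y. kern (real (Suc n)) (y - x)"
  obtain r where r: "r > 0" "\<And>y. dist y x < r \<Longrightarrow> dist (f y) (f x) < e / 2"
    using cont e unfolding continuous_at_eps_delta by (metis half_gt_zero)
  let ?G = "\<lambda>y. norm (f y - f x) * gauss 1 (y - x)"
  have "integrable lborel (\<lambda>y::'a. gauss 1 (y - x))"
    using integrable_translate_iff[of "gauss 1" "- x"] integrable_gauss[of 1, where 'a='a] by simp
  then have "integrable lborel (\<lambda>y. f y * of_real (gauss 1 (y - x)) - f x * of_real (gauss 1 (y - x)))"
    by (intro Bochner_Integration.integrable_diff int integrable_mult_right integrable_of_real)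
  from integrable_norm[OF this] have G: "integrable lborel ?G"
    by (simp add: left_diff_distrib[symmetric] norm_mult)
  define B where "B = integral\<^sup>L lborel ?G"
  define c where "c n = real (Suc n) ^ DIM('a) * exp (- pi * r\<^sup>2 * ((real (Suc n))\<^sup>2 - 1))" for n
  have bound: "norm ((LINT y|lborel. f y * of_real (?K n y)) - f x) \<le> e / 2 + c n * B" for n
  proof -
    have K: "integrable lborel (?K n)" "integral\<^sup>L lborel (?K n) = 1"
      by (simp_all add: integrable_kern integral_kern)
    have fK: "integrable lborel (\<lambda>y. f y * of_real (?K n y))"
    proof (rule Bochner_Integration.integrable_bound[OF integrable_mult_right[OF int, of "of_real (real (Suc n) ^ DIM('a))"]], measurable, intro AE_I2)
      fix y
      have "norm (f y) * ?K n y \<le> norm (f y) * (real (Suc n) ^ DIM('a) * gauss 1 (y - x))"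
        by (intro mult_left_mono kern_le_gauss) auto
      then show "norm (f y * of_real (?K n y)) \<le> norm (of_real (real (Suc n) ^ DIM('a)) * (f y * complex_of_real (gauss 1 (y - x))))"
        by (simp add: norm_mult norm_power mult_ac del: of_nat_Suc)
    qed
    have "(LINT y|lborel. f y * of_real (?K n y)) - f x = (LINT y|lborel. f y * of_real (?K n y)) - (LINT y|lborel. f x * of_real (?K n y))"
      using K by (simp del: of_nat_Suc)
    also have "\<dots> = (LINT y|lborel. (f y - f x) * of_real (?K n y))"
      using fK K by (subst Bochner_Integration.integral_diff[symmetric]) (auto simp: left_diff_distrib simp del: of_nat_Suc)
    also have "norm \<dots> \<le> (LINT y|lborel. e / 2 * ?K n y + c n * ?G y)"
    proof (rule Bochner_Integration.integral_norm_bound_integral)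
      show "integrable lborel (\<lambda>y. (f y - f x) * of_real (?K n y))"
        unfolding left_diff_distrib by (intro Bochner_Integration.integrable_diff fK integrable_mult_right integrable_of_real K)
      show "integrable lborel (\<lambda>y. e / 2 * ?K n y + c n * ?G y)"
        by (intro Bochner_Integration.integrable_add integrable_mult_right K G)
      fix y
      have cn: "c n \<ge> 0" by (simp add: c_def)
      show "norm ((f y - f x) * of_real (?K n y)) \<le> e / 2 * ?K n y + c n * ?G y"
      proof (cases "dist y x < r")
        case True
        then have "norm (f y - f x) * ?K n y \<le> e / 2 * ?K n y"
          using r(2)[OF True] by (intro mult_right_mono) (auto simp: dist_norm)
        moreover have "0 \<le> c n * ?G y" using cn by simp
        moreover have "norm ((f y - f x) * of_real (?K n y)) = norm (f y - f x) * ?K n y"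
          by (simp add: norm_mult del: of_nat_Suc)
        ultimately show ?thesis by linarith
      next
        case False
        then have "norm (f y - f x) * ?K n y \<le> norm (f y - f x) * (c n * gauss 1 (y - x))"
          unfolding c_def using r(1)
          by (intro mult_left_mono kern_le_gauss_away) (auto simp: dist_norm)
        moreover have "0 \<le> e / 2 * ?K n y" using e by simp
        moreover have "norm ((f y - f x) * of_real (?K n y)) = norm (f y - f x) * ?K n y"
          by (simp add: norm_mult del: of_nat_Suc)
        ultimately show ?thesis by (simp only: mult_ac)
      qed
    qed
    also have "\<dots> = e / 2 + c n * B"
      unfolding B_def using K G by (simp del: of_nat_Suc)
    finally show ?thesis .
  qed
  define k where "k = pi * r\<^sup>2"
  have k: "k > 0" using r(1) by (simp add: k_def)
  have "(\<lambda>n. real (Suc n) powr real DIM('a) * exp (- k * ((real (Suc n))\<^sup>2 - 1)) * B) \<longlonglongrightarrow> 0"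
    using k by real_asymp
  then have "(\<lambda>n. c n * B) \<longlonglongrightarrow> 0"
    by (simp add: c_def k_def powr_realpow del: of_nat_Suc)
  from LIMSEQ_D[OF this, of "e / 2"] e obtain N where N: "\<And>n. n \<ge> N \<Longrightarrow> norm (c n * B - 0) < e / 2" by auto
  have "norm ((LINT y|lborel. f y * of_real (?K n y)) - f x) < e" if "n \<ge> N" for n
  proof -
    have "\<bar>c n * B\<bar> < e / 2" using N[OF that] by simp
    with bound[of n] show ?thesis by linarith
  qed
  then show "\<exists>N. \<forall>n\<ge>N. norm ((LINT y|lborel. f y * of_real (?K n y)) - f x) < e"
    by blast
qed

text \<open>Fubini, with the Gaussian transform evaluated at \<xi> - L p. The general measure
  \<open>M\<close> allows three uses: pairs of frequencies with \<open>L\<close> their difference or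
  their midpoint, and \<open>lborel\<close> with \<open>L\<close> the reflection.\<close>

lemma gauss_average:
  fixes Q :: "'p \<Rightarrow> complex" and L :: "'p \<Rightarrow> 'a::euclidean_space"
  assumes "sigma_finite_measure M" and Q: "integrable M Q" and L[measurable]: "L \<in> borel_measurable M"
    and m: "m > 0"
  shows "(LINT \<tau>|lborel. (LINT p|M. Q p * osc \<tau> (L p)) * of_real (gauss (1 / m\<^sup>2) \<tau>) * osc \<tau> (- \<xi>))
       = (LINT p|M. Q p * of_real (kern m (\<xi> - L p)))"
proof -
  interpret sigma_finite_measure M by fact
  interpret pair_sigma_finite M "lborel :: 'a measure" ..
  have [measurable]: "Q \<in> borel_measurable M" using Q by auto
  let ?F = "\<lambda>p \<tau>. Q p * (of_real (gauss (1 / m\<^sup>2) \<tau>) * osc \<tau> (- (\<xi> - L p)))"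
  have F: "integrable (M \<Otimes>\<^sub>M lborel) (\<lambda>(p, \<tau>). ?F p \<tau>)"
  proof (rule Fubini_integrable)
    show "integrable M (\<lambda>p. LINT \<tau>|lborel. norm (case (p, \<tau>) of (p, \<tau>) \<Rightarrow> ?F p \<tau>))"
      using Q by (simp add: norm_mult)
    show "AE p in M. integrable lborel (\<lambda>\<tau>. case (p, \<tau>) of (p, \<tau>) \<Rightarrow> ?F p \<tau>)"
    proof (intro AE_I2)
      fix p
      show "integrable lborel (\<lambda>\<tau>. case (p, \<tau>) of (p, \<tau>) \<Rightarrow> ?F p \<tau>)"
        using integrable_gauss_osc[of "1 / m\<^sup>2" "\<xi> - L p"] m by simp
    qed
  qed measurable
  have "(LINT \<tau>|lborel. (LINT p|M. Q p * osc \<tau> (L p)) * of_real (gauss (1 / m\<^sup>2) \<tau>) * osc \<tau> (- \<xi>))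
      = (LINT \<tau>|lborel. LINT p|M. ?F p \<tau>)"
  proof (intro Bochner_Integration.integral_cong refl)
    fix \<tau>
    have eq: "?F p \<tau> = (Q p * osc \<tau> (L p)) * (of_real (gauss (1 / m\<^sup>2) \<tau>) * osc \<tau> (- \<xi>))" for p
      using osc_add_right[of \<tau> "- \<xi>" "L p"] by simp
    show "(LINT p|M. Q p * osc \<tau> (L p)) * of_real (gauss (1 / m\<^sup>2) \<tau>) * osc \<tau> (- \<xi>) = (LINT p|M. ?F p \<tau>)"
      unfolding eq integral_mult_left_zero by (simp only: mult.assoc)
  qed
  also have "\<dots> = (LINT p|M. LINT \<tau>|lborel. ?F p \<tau>)"
    by (rule Fubini_integral[OF F])
  also have "\<dots> = (LINT p|M. Q p * of_real (kern m (\<xi> - L p)))"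
    by (simp only: integral_mult_right_zero fourier_gauss_kern[OF m])
  finally show ?thesis .
qed

section \<open>Representation by the inverse Fourier transform\<close>

lemma gauss_tendsto_1: "(\<lambda>n. gauss (1 / (real (Suc n))\<^sup>2) x) \<longlonglongrightarrow> 1"
proof -
  have "(\<lambda>n. exp (- pi * (1 / (real (Suc n))\<^sup>2) * (norm x)\<^sup>2)) \<longlonglongrightarrow> exp (- pi * 0 * (norm x)\<^sup>2)"
    by (intro tendsto_intros) real_asymp
  then show ?thesis by (simp add: gauss_def)
qed

lemma tendsto_integral_gauss:
  fixes u :: "'a::euclidean_space \<Rightarrow> complex"
  assumes "integrable lborel u"
  shows "(\<lambda>n. LINT x|lborel. u x * of_real (gauss (1 / (real (Suc n))\<^sup>2) x)) \<longlonglongrightarrow> integral\<^sup>L lborel u"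
proof (rule integral_dominated_convergence[where w = "\<lambda>x. norm (u x)"])
  show "AE x in lborel. (\<lambda>n. u x * of_real (gauss (1 / (real (Suc n))\<^sup>2) x)) \<longlonglongrightarrow> u x"
  proof (intro AE_I2)
    fix x :: 'a
    have "(\<lambda>n. u x * of_real (gauss (1 / (real (Suc n))\<^sup>2) x)) \<longlonglongrightarrow> u x * of_real 1"
      by (intro tendsto_intros gauss_tendsto_1)
    then show "(\<lambda>n. u x * of_real (gauss (1 / (real (Suc n))\<^sup>2) x)) \<longlonglongrightarrow> u x" by simp
  qed
  show "AE x in lborel. norm (u x * of_real (gauss (1 / (real (Suc n))\<^sup>2) x)) \<le> norm (u x)" for n
    by (intro AE_I2) (auto simp: norm_mult intro!: mult_left_le gauss_le_1)
qed (use assms in auto)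

lemma integrable_mult_osc:
  assumes "integrable lborel u"
  shows "integrable lborel (\<lambda>\<xi>. u \<xi> * osc x \<xi>)" "integrable lborel (\<lambda>\<xi>. u \<xi> * osc \<xi> x)"
  by (rule Bochner_Integration.integrable_bound[OF assms]; use assms in \<open>auto simp: norm_mult\<close>)+

text \<open>T is applied to the transform of a modulated Gaussian, which is
  \<open>kern m (y - x)\<close>. Both functions are Schwartz, so this value can be computed from g
  and from f; the two sides converge to the two sides of the claim.\<close>

lemma represents_inverse_fourier:
  fixes f g :: "real^'n::finite \<Rightarrow> complex"
  assumes g: "represents g (fourier_distr T)" and f: "represents f T"
    and cont: "continuous_on UNIV f" and int: "integrable lborel g"
  shows "f x = (LINT \<xi>|lborel. g \<xi> * osc x \<xi>)"
proof (rule LIMSEQ_unique)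
  have four: "fourier (\<lambda>\<xi>. of_real (gauss (1 / m\<^sup>2) \<xi>) * osc x \<xi>) = (\<lambda>y. of_real (kern m (y - x)))"
    if "m > 0" for m
  proof
    fix y
    have "of_real (gauss (1 / m\<^sup>2) \<xi>) * osc x \<xi> * exp (- 2 * of_real pi * \<i> * of_real (\<xi> \<bullet> y))
        = of_real (gauss (1 / m\<^sup>2) \<xi>) * osc \<xi> (- (y - x))" for \<xi>
    proof -
      have "osc \<xi> (- (y - x)) = osc \<xi> x * osc \<xi> (- y)"
        using osc_add_right[of \<xi> x "- y"] by simp
      then show ?thesis
        unfolding osc_eq_exp[symmetric] by (simp add: osc_commute[of x] mult.assoc)
    qed
    then show "fourier (\<lambda>\<xi>. of_real (gauss (1 / m\<^sup>2) \<xi>) * osc x \<xi>) y = of_real (kern m (y - x))"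
      unfolding fourier_def by (simp only: fourier_gauss_kern[OF that])
  qed
  have eq: "(LINT \<xi>|lborel. g \<xi> * (of_real (gauss (1 / m\<^sup>2) \<xi>) * osc x \<xi>))
      = (LINT y|lborel. f y * of_real (kern m (y - x)))" if m: "m > 0" for m
  proof -
    let ?\<phi> = "\<lambda>\<xi>. of_real (gauss (1 / m\<^sup>2) \<xi>) * osc x \<xi>"
    have "?\<phi> \<in> schwartz"
      using m by (intro schwartz_gauss_osc) simp
    then have "T (fourier ?\<phi>) = (LINT \<xi>|lborel. g \<xi> * ?\<phi> \<xi>)"
      using g unfolding represents_def fourier_distr_def by blast
    moreover have "(\<lambda>y. of_real (kern m (y - x))) \<in> schwartz"
      unfolding kern_def using m by (intro schwartz_gauss_shift) simp
    then have "T (\<lambda>y. of_real (kern m (y - x))) = (LINT y|lborel. f y * of_real (kern m (y - x)))"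
      using f unfolding represents_def by blast
    ultimately show ?thesis by (simp only: four[OF m])
  qed
  have "(\<lambda>n. LINT \<xi>|lborel. (g \<xi> * osc x \<xi>) * of_real (gauss (1 / (real (Suc n))\<^sup>2) \<xi>)) \<longlonglongrightarrow> (LINT \<xi>|lborel. g \<xi> * osc x \<xi>)"
    by (intro tendsto_integral_gauss integrable_mult_osc int)
  also have "(\<lambda>n. LINT \<xi>|lborel. (g \<xi> * osc x \<xi>) * of_real (gauss (1 / (real (Suc n))\<^sup>2) \<xi>))
      = (\<lambda>n. LINT \<xi>|lborel. g \<xi> * (of_real (gauss (1 / (real (Suc n))\<^sup>2) \<xi>) * osc x \<xi>))"
    by (simp add: mult_ac)
  finally show "(\<lambda>n. LINT y|lborel. f y * of_real (kern (real (Suc n)) (y - x))) \<longlonglongrightarrow> (LINT \<xi>|lborel. g \<xi> * osc x \<xi>)"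
    by (subst (asm) eq) simp_all
  show "(\<lambda>n. LINT y|lborel. f y * of_real (kern (real (Suc n)) (y - x))) \<longlonglongrightarrow> f x"
  proof (rule approx_identity)
    show "f \<in> borel_measurable borel" using f by (simp add: represents_def)
    show "isCont f x" using cont by (simp add: continuous_on_eq_continuous_at)
    show "integrable lborel (\<lambda>y. f y * of_real (gauss 1 (y - x)))"
      using f schwartz_gauss_shift[of 1 1 x] by (simp add: represents_def)
  qed
qed

lemma
  fixes u :: "'a::euclidean_space \<Rightarrow> 'c::{real_normed_field,banach,second_countable_topology}"
    and v :: "'b::euclidean_space \<Rightarrow> 'c"
  assumes u: "integrable lborel u" and v: "integrable lborel v"
  shows integrable_pair_mult: "integrable (lborel \<Otimes>\<^sub>M lborel) (\<lambda>p. u (fst p) * v (snd p))"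
    and integral_pair_mult: "(LINT p|(lborel \<Otimes>\<^sub>M lborel). u (fst p) * v (snd p))
      = integral\<^sup>L lborel u * integral\<^sup>L lborel v"
proof -
  have [measurable]: "u \<in> borel_measurable borel" "v \<in> borel_measurable borel" using u v by auto
  show *: "integrable (lborel \<Otimes>\<^sub>M lborel) (\<lambda>p. u (fst p) * v (snd p))"
    by (rule lborel_pair.Fubini_integrable) (use u v in \<open>auto simp: norm_mult\<close>)
  show "(LINT p|(lborel \<Otimes>\<^sub>M lborel). u (fst p) * v (snd p)) = integral\<^sup>L lborel u * integral\<^sup>L lborel v"
    using lborel_pair.integral_fst'[OF *] by simp
qed

lemma sigma_finite_lborel_pair:
  "sigma_finite_measure (lborel \<Otimes>\<^sub>M lborel :: ('a::euclidean_space \<times> 'b::euclidean_space) measure)"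
  unfolding lborel_prod by (rule sigma_finite_lborel)

text \<open>Half of Plancherel's theorem: the Gaussian averages of \<open>\<bar>F\<bar>\<^sup>2\<close> are
  \<open>\<integral>\<integral> g(a) cnj (g(b)) K(a - b) da db\<close>, which Schur's test bounds by \<open>\<integral> \<bar>g\<bar>\<^sup>2\<close>.\<close>
lemma square_integrable_inverse_fourier:
  fixes g :: "'a::euclidean_space \<Rightarrow> complex"
  assumes g: "integrable lborel g" and g2: "integrable lborel (\<lambda>\<xi>. (norm (g \<xi>))\<^sup>2)"
  defines "F \<equiv> \<lambda>x. LINT \<xi>|lborel. g \<xi> * osc x \<xi>"
  shows "integrable lborel (\<lambda>x. (norm (F x))\<^sup>2)"
proof -
  have [measurable]: "g \<in> borel_measurable borel" using g by auto
  have [measurable]: "F \<in> borel_measurable borel" unfolding F_def by measurable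
  have F_bound: "norm (F x) \<le> (LINT \<xi>|lborel. norm (g \<xi>))" for x
    unfolding F_def by (rule order_trans[OF integral_norm_bound]) (simp add: norm_mult)
  define I where "I = (LINT \<xi>|lborel. (norm (g \<xi>))\<^sup>2)"
  let ?\<gamma> = "\<lambda>n. gauss (1 / (real (Suc n))\<^sup>2)"
  let ?K = "\<lambda>n. kern (real (Suc n))"
  let ?Q = "\<lambda>p. g (fst p) * cnj (g (snd p))"
  have Q: "integrable (lborel \<Otimes>\<^sub>M lborel) ?Q"
    using g by (intro integrable_pair_mult integrable_cnj)
  have FF: "F x * cnj (F x) = (LINT p|(lborel \<Otimes>\<^sub>M lborel). ?Q p * osc x (fst p - snd p))" for x
  proof -
    have "F x * cnj (F x) = (LINT p|(lborel \<Otimes>\<^sub>M lborel). (g (fst p) * osc x (fst p)) * cnj (g (snd p) * osc x (snd p)))"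
      unfolding F_def Bochner_Integration.integral_cnj[symmetric] using g
      by (intro integral_pair_mult[symmetric] integrable_cnj integrable_mult_osc)
    also have "(\<lambda>p. (g (fst p) * osc x (fst p)) * cnj (g (snd p) * osc x (snd p))) = (\<lambda>p. ?Q p * osc x (fst p - snd p))"
      by (intro ext) (simp add: cnj_osc diff_conv_add_uminus osc_add_right mult_ac del: add_uminus_conv_diff)
    finally show ?thesis .
  qed
  \<comment> \<open>F is bounded since g is in L^1. This integrability later converts the bound
    \<open>le\<close>, which concerns Bochner integrals, into one on the nonnegative integrals in
    Fatou's lemma.\<close>
  have int: "integrable lborel (\<lambda>x. (norm (F x))\<^sup>2 * ?\<gamma> n x)" for n
  proof (rule Bochner_Integration.integrable_bound)
    show "integrable lborel (\<lambda>x::'a. (LINT \<xi>|lborel. norm (g \<xi>))\<^sup>2 * ?\<gamma> n x)"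
      by (intro integrable_mult_right integrable_gauss) simp
    show "AE x in lborel. norm ((norm (F x))\<^sup>2 * ?\<gamma> n x) \<le> norm ((LINT \<xi>|lborel. norm (g \<xi>))\<^sup>2 * ?\<gamma> n x)"
      by (intro AE_I2) (auto intro!: mult_right_mono power_mono F_bound)
  qed measurable
  have le: "(LINT x|lborel. (norm (F x))\<^sup>2 * ?\<gamma> n x) \<le> I" for n
  proof -
    \<comment> \<open>The kernel has mass 1 in either variable, so each half of the coming Schur
      estimate integrates to \<open>I\<close>; the other half follows by swapping, as the kernel is
      even.\<close>
    have g2K: "integrable (lborel \<Otimes>\<^sub>M lborel) (\<lambda>p. (norm (g (fst p)))\<^sup>2 * ?K n (snd p - fst p))"
      and g2K_eq: "(LINT p|(lborel \<Otimes>\<^sub>M lborel). (norm (g (fst p)))\<^sup>2 * ?K n (snd p - fst p)) = I"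
    proof -
      show *: "integrable (lborel \<Otimes>\<^sub>M lborel) (\<lambda>p. (norm (g (fst p)))\<^sup>2 * ?K n (snd p - fst p))"
        by (rule lborel_pair.Fubini_integrable)
          (use g2 in \<open>auto simp: norm_mult integrable_kern integral_kern simp del: of_nat_Suc\<close>)
      show "(LINT p|(lborel \<Otimes>\<^sub>M lborel). (norm (g (fst p)))\<^sup>2 * ?K n (snd p - fst p)) = I"
        using lborel_pair.integral_fst'[OF *] by (simp add: integral_kern I_def del: of_nat_Suc)
    qed
    have sw: "kern m (x - y) = kern m (y - x)" for m and x y :: 'a
      using kern_minus[of m "x - y"] by simp
    have g2K': "integrable (lborel \<Otimes>\<^sub>M lborel) (\<lambda>p. (norm (g (snd p)))\<^sup>2 * ?K n (snd p - fst p))"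
      and g2K'_eq: "(LINT p|(lborel \<Otimes>\<^sub>M lborel). (norm (g (snd p)))\<^sup>2 * ?K n (snd p - fst p)) = I"
      using lborel_pair.integrable_product_swap[OF g2K] lborel_pair.integral_product_swap[of "\<lambda>p. (norm (g (fst p)))\<^sup>2 * ?K n (snd p - fst p)"] g2K_eq
      by (simp_all add: case_prod_unfold sw del: of_nat_Suc)
    have "complex_of_real (LINT x|lborel. (norm (F x))\<^sup>2 * ?\<gamma> n x)
        = (LINT x|lborel. (LINT p|(lborel \<Otimes>\<^sub>M lborel). ?Q p * osc x (fst p - snd p)) * of_real (?\<gamma> n x) * osc x (- 0))"
      unfolding FF[symmetric] integral_complex_of_real[symmetric]
      by (simp add: complex_norm_square[symmetric] del: of_nat_Suc)
    also have "\<dots> = (LINT p|(lborel \<Otimes>\<^sub>M lborel). ?Q p * of_real (?K n (0 - (fst p - snd p))))"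
      by (rule gauss_average[OF sigma_finite_lborel_pair Q]) auto
    finally have avg: "complex_of_real (LINT x|lborel. (norm (F x))\<^sup>2 * ?\<gamma> n x)
        = (LINT p|(lborel \<Otimes>\<^sub>M lborel). ?Q p * of_real (?K n (0 - (fst p - snd p))))" .
    have "\<bar>LINT x|lborel. (norm (F x))\<^sup>2 * ?\<gamma> n x\<bar> = norm (complex_of_real (LINT x|lborel. (norm (F x))\<^sup>2 * ?\<gamma> n x))"
      by (simp only: norm_of_real)
    also have "\<dots> = norm (LINT p|(lborel \<Otimes>\<^sub>M lborel). ?Q p * of_real (?K n (0 - (fst p - snd p))))"
      by (simp only: avg)
    also have "\<dots> \<le> (LINT p|(lborel \<Otimes>\<^sub>M lborel). norm (?Q p * of_real (?K n (0 - (fst p - snd p)))))"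
      by (rule integral_norm_bound)
    also have "\<dots> \<le> (LINT p|(lborel \<Otimes>\<^sub>M lborel). ((norm (g (fst p)))\<^sup>2 * ?K n (snd p - fst p) + (norm (g (snd p)))\<^sup>2 * ?K n (snd p - fst p)) / 2)"
    proof (rule integral_mono')
      fix p :: "'a \<times> 'a"
      \<comment> \<open>|g(a)| |g(b)| is at most the mean of the two squares, and each square pairs
        with a full integral of the kernel.\<close>
      have "2 * (norm (g (fst p)) * norm (g (snd p))) \<le> (norm (g (fst p)))\<^sup>2 + (norm (g (snd p)))\<^sup>2"
        using sum_squares_bound[of "norm (g (fst p))" "norm (g (snd p))"] by (simp add: mult_ac)
      then have "norm (g (fst p)) * norm (g (snd p)) * ?K n (snd p - fst p) \<le> ((norm (g (fst p)))\<^sup>2 + (norm (g (snd p)))\<^sup>2) / 2 * ?K n (snd p - fst p)"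
        by (intro mult_right_mono) auto
      then show "norm (?Q p * of_real (?K n (0 - (fst p - snd p)))) \<le> ((norm (g (fst p)))\<^sup>2 * ?K n (snd p - fst p) + (norm (g (snd p)))\<^sup>2 * ?K n (snd p - fst p)) / 2"
        by (simp add: norm_mult algebra_simps add_divide_distrib del: of_nat_Suc)
    qed (use g2K g2K' in \<open>auto simp del: of_nat_Suc\<close>)
    also have "\<dots> = I"
      using g2K g2K' by (simp add: g2K_eq g2K'_eq del: of_nat_Suc)
    finally show ?thesis by linarith
  qed
  show ?thesis
  proof (rule integrableI_bounded)
    have lim: "(\<lambda>n. ennreal ((norm (F x))\<^sup>2 * ?\<gamma> n x)) \<longlonglongrightarrow> ennreal (norm ((norm (F x))\<^sup>2))" for x
    proof -
      have "(\<lambda>n. (norm (F x))\<^sup>2 * ?\<gamma> n x) \<longlonglongrightarrow> (norm (F x))\<^sup>2 * 1"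
        by (intro tendsto_intros gauss_tendsto_1)
      then show ?thesis by (intro tendsto_ennrealI) simp
    qed
    have "(\<integral>\<^sup>+x. ennreal (norm ((norm (F x))\<^sup>2)) \<partial>lborel) = (\<integral>\<^sup>+x. liminf (\<lambda>n. ennreal ((norm (F x))\<^sup>2 * ?\<gamma> n x)) \<partial>lborel)"
      by (intro nn_integral_cong lim_imp_Liminf[OF _ lim, symmetric]) auto
    also have "\<dots> \<le> liminf (\<lambda>n. \<integral>\<^sup>+x. ennreal ((norm (F x))\<^sup>2 * ?\<gamma> n x) \<partial>lborel)"
      by (rule nn_integral_liminf) measurable
    also have "\<dots> \<le> liminf (\<lambda>n::nat. ennreal I)"
    proof (intro Liminf_mono always_eventually allI)
      fix n
      have "(\<integral>\<^sup>+x. ennreal ((norm (F x))\<^sup>2 * ?\<gamma> n x) \<partial>lborel) = ennreal (LINT x|lborel. (norm (F x))\<^sup>2 * ?\<gamma> n x)"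
        by (rule nn_integral_eq_integral[OF int]) auto
      then show "(\<integral>\<^sup>+x. ennreal ((norm (F x))\<^sup>2 * ?\<gamma> n x) \<partial>lborel) \<le> ennreal I"
        using le[of n] by (simp add: ennreal_leI del: of_nat_Suc)
    qed
    also have "\<dots> = ennreal I" by (simp add: Liminf_const)
    also have "\<dots> < \<infinity>" by simp
    finally show "(\<integral>\<^sup>+x. ennreal (norm ((norm (F x))\<^sup>2)) \<partial>lborel) < \<infinity>" .
  qed measurable
qed

section \<open>Integrability of the transform, inversion and moments\<close>

text \<open>Split |\<xi>| \<le> |a| + |\<xi> - a|. Half of the Gaussian exponent absorbs the factor
  |\<xi> - a|, and the wider Gaussian that remains has mass \<open>sqrt 2 ^ DIM('a)\<close> whatever
  m is. Uniformity in m is the point.\<close>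

lemma nn_integral_kern_weighted_le:
  fixes a :: "'a::euclidean_space"
  assumes m: "m \<ge> 1"
  shows "(\<integral>\<^sup>+\<xi>. ennreal ((1 + norm \<xi>) * kern m (\<xi> - a)) \<partial>lborel) \<le> ennreal (1 + norm a + sqrt 2 ^ DIM('a))"
proof -
  \<comment> \<open>r \<le> 1 + r^2 / 2 \<le> exp (pi m^2 r^2 / 2), where m \<ge> 1 gives pi m^2
    \<ge> 1.\<close>
  have r: "r \<le> exp (pi * m\<^sup>2 * r\<^sup>2 / 2)" for r :: real
  proof -
    have "0 \<le> (1 - r)\<^sup>2" by simp
    then have "r \<le> 1 + r\<^sup>2 / 2" by (simp add: power2_eq_square algebra_simps)
    also have "r\<^sup>2 / 2 \<le> pi * m\<^sup>2 * (r\<^sup>2 / 2)"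
    proof -
      have "1 * 1 \<le> pi * m\<^sup>2"
        using m pi_gt3 by (intro mult_mono one_le_power) auto
      then have "1 * (r\<^sup>2 / 2) \<le> pi * m\<^sup>2 * (r\<^sup>2 / 2)" by (intro mult_right_mono) auto
      then show ?thesis by simp
    qed
    also have "1 + \<dots> \<le> exp \<dots>" by (rule exp_ge_add_one_self)
    finally show ?thesis by simp
  qed
  have nz: "norm z * kern m z \<le> m ^ DIM('a) * gauss (m\<^sup>2 / 2) z" for z :: 'a
  proof -
    have "norm z * gauss (m\<^sup>2) z \<le> exp (pi * m\<^sup>2 * (norm z)\<^sup>2 / 2) * gauss (m\<^sup>2) z"
      by (intro mult_right_mono r) auto
    also have "\<dots> = gauss (m\<^sup>2 / 2) z"
      by (simp add: gauss_def exp_add[symmetric])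
    finally show ?thesis
      unfolding kern_def using m by (simp add: mult.left_commute mult_left_mono)
  qed
  let ?h = "\<lambda>z::'a. (1 + norm a) * kern m z + m ^ DIM('a) * gauss (m\<^sup>2 / 2) z"
  have K: "integrable lborel (kern m :: 'a \<Rightarrow> real)" "(LINT z::'a|lborel. kern m z) = 1"
    using integrable_kern[of m "0::'a"] integral_kern[of m "0::'a"] m by simp_all
  have G: "integrable lborel (gauss (m\<^sup>2 / 2) :: 'a \<Rightarrow> real)"
    using m by (intro integrable_gauss) simp
  have Gi: "m ^ DIM('a) * (LINT z::'a|lborel. gauss (m\<^sup>2 / 2) z) = sqrt 2 ^ DIM('a)"
    using m by (subst integral_gauss) (simp_all add: power_mult_distrib[symmetric] real_sqrt_divide)
  have "(\<integral>\<^sup>+\<xi>. ennreal ((1 + norm \<xi>) * kern m (\<xi> - a)) \<partial>lborel) \<le> (\<integral>\<^sup>+\<xi>. ennreal (?h (\<xi> + - a)) \<partial>lborel)"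
  proof (intro nn_integral_mono ennreal_leI)
    fix \<xi> :: 'a
    have "norm \<xi> \<le> norm a + norm (\<xi> - a)" by norm
    then have "(1 + norm \<xi>) * kern m (\<xi> - a) \<le> (1 + norm a + norm (\<xi> - a)) * kern m (\<xi> - a)"
      using m by (intro mult_right_mono) auto
    with nz[of "\<xi> - a"] show "(1 + norm \<xi>) * kern m (\<xi> - a) \<le> ?h (\<xi> + - a)"
      by (simp add: algebra_simps)
  qed
  also have "\<dots> = (\<integral>\<^sup>+z. ennreal (?h z) \<partial>lborel)"
    by (rule nn_integral_translate) measurable
  also have "\<dots> = ennreal (LINT z|lborel. ?h z)"
    using K G m by (intro nn_integral_eq_integral) auto
  also have "(LINT z|lborel. ?h z) = 1 + norm a + sqrt 2 ^ DIM('a)"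
    using K G Gi by simp
  finally show ?thesis .
qed

text \<open>The Gaussian means of the Fourier transform of \<open>h\<close> average the measure \<open>Q dM\<close> pushed
  forward by \<open>L\<close>, so their weighted \<open>L\<^sup>1\<close> norms are bounded uniformly; Fatou's lemma then bounds
  the transform itself, without identifying it with a density of that measure.\<close>
lemma integrable_weighted_fourier:
  fixes Q :: "'p \<Rightarrow> complex" and L :: "'p \<Rightarrow> 'a::euclidean_space"
  assumes M: "sigma_finite_measure M" and Q: "integrable M Q" and L[measurable]: "L \<in> borel_measurable M"
    and QL: "integrable M (\<lambda>p. norm (L p) * norm (Q p))"
    and h: "integrable lborel h" and h_eq: "\<And>\<tau>. h \<tau> = (LINT p|M. Q p * osc \<tau> (L p))"
  shows "integrable lborel (\<lambda>\<xi>. (1 + norm \<xi>) * norm (LINT \<tau>|lborel. h \<tau> * osc \<tau> (- \<xi>)))"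
proof -
  interpret sigma_finite_measure M by fact
  interpret pair_sigma_finite M "lborel :: 'a measure" ..
  have [measurable]: "Q \<in> borel_measurable M" using Q by auto
  have [measurable]: "h \<in> borel_measurable borel" using h by auto
  let ?\<gamma> = "\<lambda>n. gauss (1 / (real (Suc n))\<^sup>2)"
  let ?K = "\<lambda>n. kern (real (Suc n))"
  define W where "W \<xi> = (LINT \<tau>|lborel. h \<tau> * osc \<tau> (- \<xi>))" for \<xi>
  define V where "V n \<xi> = (LINT p|M. Q p * of_real (?K n (\<xi> - L p)))" for n \<xi>
  have [measurable]: "W \<in> borel_measurable borel" unfolding W_def by measurable
  have [measurable]: "V n \<in> borel_measurable borel" for n unfolding V_def by measurable
  have V_lim: "(\<lambda>n. V n \<xi>) \<longlonglongrightarrow> W \<xi>" for \<xi>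
  proof -
    \<comment> \<open>\<open>gauss_average\<close> read backwards: the smeared superposition is the
      Gaussian-weighted transform of h, and h in L^1 lets the Gaussian be removed in the
      limit.\<close>
    have "V n \<xi> = (LINT \<tau>|lborel. (h \<tau> * osc \<tau> (- \<xi>)) * of_real (?\<gamma> n \<tau>))" for n
      unfolding V_def gauss_average[OF M Q L, of "real (Suc n)" \<xi>, OF of_nat_0_less_iff[THEN iffD2, OF zero_less_Suc], symmetric]
        h_eq[symmetric] by (simp only: mult_ac)
    then show ?thesis
      unfolding W_def by (simp only:) (intro tendsto_integral_gauss integrable_mult_osc h)
  qed
  define C where "C = sqrt 2 ^ DIM('a)"
  have C: "C \<ge> 0" by (simp add: C_def)
  define B where "B = (\<integral>\<^sup>+p. ennreal (norm (Q p) * (1 + norm (L p) + C)) \<partial>M)"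
  have B: "B < \<infinity>"
  proof -
    have "integrable M (\<lambda>p. (1 + C) * norm (Q p) + norm (L p) * norm (Q p))"
      by (intro Bochner_Integration.integrable_add integrable_mult_right integrable_norm Q QL)
    then have "integrable M (\<lambda>p. norm (Q p) * (1 + norm (L p) + C))"
      by (simp add: algebra_simps)
    from nn_integral_eq_integral[OF this] C show ?thesis by (simp add: B_def)
  qed
  have V_le: "(\<integral>\<^sup>+\<xi>. ennreal ((1 + norm \<xi>) * norm (V n \<xi>)) \<partial>lborel) \<le> B" for n
  proof -
    let ?f = "\<lambda>p \<xi>. ennreal ((1 + norm \<xi>) * (norm (Q p) * ?K n (\<xi> - L p)))"
    have "(\<integral>\<^sup>+\<xi>. ennreal ((1 + norm \<xi>) * norm (V n \<xi>)) \<partial>lborel) \<le> (\<integral>\<^sup>+\<xi>. (\<integral>\<^sup>+p. ?f p \<xi> \<partial>M) \<partial>lborel)"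
    proof (rule nn_integral_mono)
      fix \<xi> :: 'a
      have "ennreal (norm (V n \<xi>)) \<le> (\<integral>\<^sup>+p. ennreal (norm (Q p * of_real (?K n (\<xi> - L p)))) \<partial>M)"
      \<comment> \<open>Without integrability the Bochner integral \<open>V n \<xi>\<close> takes
        the default value 0, so the bound holds in either case.\<close>
      proof (cases "integrable M (\<lambda>p. Q p * of_real (?K n (\<xi> - L p)))")
        case True
        then show ?thesis unfolding V_def by (rule integral_norm_bound_ennreal)
      next
        case False
        then show ?thesis by (simp add: V_def not_integrable_integral_eq)
      qed
      then have "ennreal (1 + norm \<xi>) * ennreal (norm (V n \<xi>))
          \<le> ennreal (1 + norm \<xi>) * (\<integral>\<^sup>+p. ennreal (norm (Q p * of_real (?K n (\<xi> - L p)))) \<partial>M)"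
        by (rule mult_left_mono) simp
      also have "\<dots> = (\<integral>\<^sup>+p. ?f p \<xi> \<partial>M)"
        by (subst nn_integral_cmult[symmetric])
          (auto simp: norm_mult ennreal_mult[symmetric] simp del: of_nat_Suc ennreal_plus)
      finally show "ennreal ((1 + norm \<xi>) * norm (V n \<xi>)) \<le> (\<integral>\<^sup>+p. ?f p \<xi> \<partial>M)"
        by (simp add: ennreal_mult del: of_nat_Suc)
    qed
    also have "\<dots> = (\<integral>\<^sup>+p. (\<integral>\<^sup>+\<xi>. ?f p \<xi> \<partial>lborel) \<partial>M)"
      by (rule Fubini') measurable
    also have "\<dots> \<le> B"
      unfolding B_def
    proof (rule nn_integral_mono)
      fix p
      have "(\<integral>\<^sup>+\<xi>. ?f p \<xi> \<partial>lborel) = ennreal (norm (Q p)) * (\<integral>\<^sup>+\<xi>. ennreal ((1 + norm \<xi>) * ?K n (\<xi> - L p)) \<partial>lborel)"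
        by (subst nn_integral_cmult[symmetric])
          (auto simp: ennreal_mult[symmetric] mult_ac simp del: of_nat_Suc)
      also have "\<dots> \<le> ennreal (norm (Q p)) * ennreal (1 + norm (L p) + C)"
        unfolding C_def by (intro mult_left_mono nn_integral_kern_weighted_le) auto
      finally show "(\<integral>\<^sup>+\<xi>. ?f p \<xi> \<partial>lborel) \<le> ennreal (norm (Q p) * (1 + norm (L p) + C))"
        using C by (simp add: ennreal_mult)
    qed
    finally show ?thesis .
  qed
  have "integrable lborel (\<lambda>\<xi>. (1 + norm \<xi>) * norm (W \<xi>))"
  proof (rule integrableI_bounded)
    have lim: "(\<lambda>n. ennreal ((1 + norm \<xi>) * norm (V n \<xi>))) \<longlonglongrightarrow> ennreal (norm ((1 + norm \<xi>) * norm (W \<xi>)))" for \<xi>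
    proof -
      have "(\<lambda>n. (1 + norm \<xi>) * norm (V n \<xi>)) \<longlonglongrightarrow> (1 + norm \<xi>) * norm (W \<xi>)"
        by (intro tendsto_intros V_lim)
      then show ?thesis by (intro tendsto_ennrealI) simp
    qed
    have "(\<integral>\<^sup>+\<xi>. ennreal (norm ((1 + norm \<xi>) * norm (W \<xi>))) \<partial>lborel)
        = (\<integral>\<^sup>+\<xi>. liminf (\<lambda>n. ennreal ((1 + norm \<xi>) * norm (V n \<xi>))) \<partial>lborel)"
      by (intro nn_integral_cong lim_imp_Liminf[OF _ lim, symmetric]) auto
    also have "\<dots> \<le> liminf (\<lambda>n. \<integral>\<^sup>+\<xi>. ennreal ((1 + norm \<xi>) * norm (V n \<xi>)) \<partial>lborel)"
      by (rule nn_integral_liminf) measurable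
    also have "\<dots> \<le> liminf (\<lambda>n::nat. B)"
      by (intro Liminf_mono always_eventually allI V_le)
    also have "\<dots> = B" by (simp add: Liminf_const)
    also have "\<dots> < \<infinity>" by (rule B)
    finally show "(\<integral>\<^sup>+\<xi>. ennreal (norm ((1 + norm \<xi>) * norm (W \<xi>))) \<partial>lborel) < \<infinity>" .
  qed measurable
  then show ?thesis by (simp add: W_def)
qed

text \<open>\<open>gauss_average\<close> with h as amplitude over \<open>lborel\<close>: the
  Gaussian-weighted inverse transform of W smears h by \<open>kern m\<close>. As m grows, one side
  tends to the inverse integral and the other to h, by continuity.\<close>

lemma fourier_inversion:
  fixes h :: "'a::euclidean_space \<Rightarrow> complex"
  assumes h: "integrable lborel h" and cont: "continuous_on UNIV h"
  defines "W \<equiv> \<lambda>\<xi>. LINT \<tau>|lborel. h \<tau> * osc \<tau> (- \<xi>)"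
  assumes W: "integrable lborel W"
  shows "h \<tau> = (LINT \<xi>|lborel. W \<xi> * osc \<tau> \<xi>)"
proof (rule LIMSEQ_unique)
  show "(\<lambda>n. LINT y|lborel. h y * of_real (kern (real (Suc n)) (y - \<tau>))) \<longlonglongrightarrow> h \<tau>"
  proof (rule approx_identity)
    show "h \<in> borel_measurable borel" using h by auto
    then have [measurable]: "h \<in> borel_measurable borel" .
    show "isCont h \<tau>" using cont by (simp add: continuous_on_eq_continuous_at)
    show "integrable lborel (\<lambda>y. h y * of_real (gauss 1 (y - \<tau>)))"
      by (rule Bochner_Integration.integrable_bound[OF h], measurable)
        (auto simp: norm_mult intro!: mult_left_le gauss_le_1)
  qed
  have eq: "(LINT y|lborel. h y * of_real (kern m (y - \<tau>)))
      = (LINT \<xi>|lborel. (W \<xi> * osc \<tau> \<xi>) * of_real (gauss (1 / m\<^sup>2) \<xi>))" if m: "m > 0" for m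
  proof -
    \<comment> \<open>Here \<xi> is the integration variable of the Gaussian mean, the frequency map
      is y \<mapsto> - y and the evaluation point is - \<tau>; hence the doubled signs.\<close>
    have "(LINT \<xi>|lborel. (LINT y|lborel. h y * osc \<xi> (- y)) * of_real (gauss (1 / m\<^sup>2) \<xi>) * osc \<xi> (- (- \<tau>)))
        = (LINT y|lborel. h y * of_real (kern m (- \<tau> - - y)))"
      by (rule gauss_average[OF sigma_finite_lborel h _ m]) measurable
    moreover have "osc y (- \<xi>) = osc \<xi> (- y)" for y \<xi> :: 'a
      by (metis osc_commute osc_minus_left)
    ultimately show ?thesis
      unfolding W_def osc_commute[of \<tau>] by (simp add: mult_ac)
  qed
  have "(\<lambda>n. LINT \<xi>|lborel. (W \<xi> * osc \<tau> \<xi>) * of_real (gauss (1 / (real (Suc n))\<^sup>2) \<xi>)) \<longlonglongrightarrow> (LINT \<xi>|lborel. W \<xi> * osc \<tau> \<xi>)"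
    by (intro tendsto_integral_gauss integrable_mult_osc W)
  then show "(\<lambda>n. LINT y|lborel. h y * of_real (kern (real (Suc n)) (y - \<tau>))) \<longlonglongrightarrow> (LINT \<xi>|lborel. W \<xi> * osc \<tau> \<xi>)"
    by (subst eq) simp_all
qed

lemma norm_cis_minus_1_le: "norm (cis x - 1) \<le> \<bar>x\<bar>"
  using iexp_approx1[of x 0] by (simp add: cis_conv_exp)

text \<open>Dominated convergence is applied to sequences, so the derivative is read along the steps
  1/(n+1).\<close>

lemma LIMSEQ_difference_quotient:
  fixes \<phi> :: "real \<Rightarrow> 'a::real_normed_vector"
  assumes "(\<phi> has_vector_derivative D) (at 0)"
  shows "(\<lambda>n. real (Suc n) *\<^sub>R (\<phi> (1 / real (Suc n)) - \<phi> 0)) \<longlonglongrightarrow> D"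
proof -
  have "((\<lambda>s. (\<phi> s - \<phi> 0) /\<^sub>R s) \<longlongrightarrow> D) (at 0)"
  proof (rule Lim_transform_eventually[OF Lim_null[THEN iffD2]])
    have "((\<lambda>s. norm (\<phi> s - \<phi> 0 - s *\<^sub>R D) / norm s) \<longlongrightarrow> 0) (at 0)"
      using assms unfolding has_vector_derivative_def has_derivative_at by simp
    \<comment> \<open>The value \<open>D\<close> at s = 0 makes the identity hold there too:
      division by zero gives 0 on the left, and the right side is the norm of D - D.\<close>
    moreover have "norm (\<phi> s - \<phi> 0 - s *\<^sub>R D) / norm s = norm ((if s = 0 then D else (\<phi> s - \<phi> 0) /\<^sub>R s) - D)" for s
    proof (cases "s = 0")
      case False
      then have "(\<phi> s - \<phi> 0) /\<^sub>R s - D = (\<phi> s - \<phi> 0 - s *\<^sub>R D) /\<^sub>R s"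
        by (simp add: scaleR_diff_right)
      with False show ?thesis by (simp add: divide_inverse mult.commute)
    qed simp
    ultimately show "((\<lambda>s. (if s = 0 then D else (\<phi> s - \<phi> 0) /\<^sub>R s) - D) \<longlongrightarrow> 0) (at 0)"
      by (simp add: tendsto_norm_zero_iff)
    show "\<forall>\<^sub>F s in at 0. (if s = 0 then D else (\<phi> s - \<phi> 0) /\<^sub>R s) = (\<phi> s - \<phi> 0) /\<^sub>R s"
      by (simp add: eventually_at_filter)
  qed
  moreover have "filterlim (\<lambda>n. 1 / real (Suc n)) (at 0) sequentially"
    by real_asymp
  ultimately have "(\<lambda>n. (\<phi> (1 / real (Suc n)) - \<phi> 0) /\<^sub>R (1 / real (Suc n))) \<longlonglongrightarrow> D"
    by (rule filterlim_compose)
  then show ?thesis by (simp add: inverse_eq_divide)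
qed

text \<open>The derivative of h along \<open>e\<close> is assumed, so only its value must be found:
  difference quotients under the integral are dominated by 2 pi |e \<bullet> \<xi>| |W|, because
  |cis x - 1| \<le> |x|.\<close>

lemma inverse_fourier_moment:
  fixes W :: "'a::euclidean_space \<Rightarrow> complex"
  assumes W: "integrable lborel (\<lambda>\<xi>. (1 + norm \<xi>) * norm (W \<xi>))" and [measurable]: "W \<in> borel_measurable borel"
    and h: "\<And>\<tau>. h \<tau> = (LINT \<xi>|lborel. W \<xi> * osc \<tau> \<xi>)"
    and D: "((\<lambda>s. h (s *\<^sub>R e)) has_vector_derivative D) (at 0)"
  shows "integrable lborel (\<lambda>\<xi>. of_real (e \<bullet> \<xi>) * W \<xi>)"
    and "2 * pi * \<i> * (LINT \<xi>|lborel. of_real (e \<bullet> \<xi>) * W \<xi>) = D"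
proof -
  have W1: "integrable lborel W"
    by (rule Bochner_Integration.integrable_bound[OF W]) (auto simp: algebra_simps)
  have We: "norm (of_real (e \<bullet> \<xi>) * W \<xi>) \<le> norm (norm e * ((1 + norm \<xi>) * norm (W \<xi>)))" for \<xi>
  proof -
    have "\<bar>e \<bullet> \<xi>\<bar> \<le> norm e * norm \<xi>" by (rule Cauchy_Schwarz_ineq2)
    also have "\<dots> \<le> norm e * (1 + norm \<xi>)" by (intro mult_left_mono) auto
    finally have "\<bar>e \<bullet> \<xi>\<bar> * norm (W \<xi>) \<le> norm e * (1 + norm \<xi>) * norm (W \<xi>)"
      by (rule mult_right_mono) simp
    then show ?thesis by (simp add: norm_mult mult.assoc)
  qed
  show int: "integrable lborel (\<lambda>\<xi>. of_real (e \<bullet> \<xi>) * W \<xi>)"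
    by (rule Bochner_Integration.integrable_bound[OF integrable_mult_right[OF W, of "norm e"]])
      (use We in auto)
  \<comment> \<open>The factor \<open>osc (0 *\<^sub>R e) \<xi>\<close> is left unsimplified to
    match the quotient in \<open>LIMSEQ_difference_quotient\<close>.\<close>
  let ?q = "\<lambda>n \<xi>. real (Suc n) *\<^sub>R (W \<xi> * osc ((1 / real (Suc n)) *\<^sub>R e) \<xi> - W \<xi> * osc (0 *\<^sub>R e) \<xi>)"
  have "(\<lambda>n. LINT \<xi>|lborel. ?q n \<xi>) \<longlonglongrightarrow> (LINT \<xi>|lborel. 2 * pi * \<i> * (of_real (e \<bullet> \<xi>) * W \<xi>))"
  proof (rule integral_dominated_convergence[where w = "\<lambda>\<xi>. 2 * pi * norm (of_real (e \<bullet> \<xi>) * W \<xi>)"])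
    show "AE \<xi> in lborel. (\<lambda>n. ?q n \<xi>) \<longlonglongrightarrow> 2 * pi * \<i> * (of_real (e \<bullet> \<xi>) * W \<xi>)"
    proof (intro AE_I2 LIMSEQ_difference_quotient)
      fix \<xi> :: 'a
      \<comment> \<open>The derivative is taken in a complex variable and then restricted to the
        real line.\<close>
      have "((\<lambda>z. W \<xi> * exp (\<i> * (2 * pi * (z * (e \<bullet> \<xi>))))) has_field_derivative
          2 * pi * \<i> * (of_real (e \<bullet> \<xi>) * W \<xi>)) (at (of_real 0))"
        by (auto intro!: derivative_eq_intros)
      from has_vector_derivative_real_field[OF this]
      show "((\<lambda>s. W \<xi> * osc (s *\<^sub>R e) \<xi>) has_vector_derivative 2 * pi * \<i> * (of_real (e \<bullet> \<xi>) * W \<xi>)) (at 0)"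
        by (simp add: osc_def cis_conv_exp)
    qed
    show "AE \<xi> in lborel. norm (?q n \<xi>) \<le> 2 * pi * norm (of_real (e \<bullet> \<xi>) * W \<xi>)" for n
    proof (intro AE_I2)
      fix \<xi> :: 'a
      have "?q n \<xi> = real (Suc n) *\<^sub>R (W \<xi> * (osc ((1 / real (Suc n)) *\<^sub>R e) \<xi> - 1))"
        by (simp add: algebra_simps)
      also have "norm \<dots> = real (Suc n) * (norm (W \<xi>) * norm (osc ((1 / real (Suc n)) *\<^sub>R e) \<xi> - 1))"
        by (simp add: norm_mult)
      also have "\<dots> \<le> real (Suc n) * (norm (W \<xi>) * \<bar>2 * pi * ((1 / real (Suc n)) *\<^sub>R e \<bullet> \<xi>)\<bar>)"
        unfolding osc_def by (intro mult_left_mono norm_cis_minus_1_le) auto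
      also have "\<dots> = 2 * pi * norm (of_real (e \<bullet> \<xi>) * W \<xi>)"
        by (simp add: norm_mult abs_mult field_simps del: of_nat_Suc)
      finally show "norm (?q n \<xi>) \<le> 2 * pi * norm (of_real (e \<bullet> \<xi>) * W \<xi>)" .
    qed
    show "integrable lborel (\<lambda>\<xi>. 2 * pi * norm (of_real (e \<bullet> \<xi>) * W \<xi>))"
      by (intro integrable_mult_right integrable_norm int)
  qed measurable
  moreover have "(LINT \<xi>|lborel. ?q n \<xi>) = real (Suc n) *\<^sub>R (h ((1 / real (Suc n)) *\<^sub>R e) - h (0 *\<^sub>R e))" for n
    unfolding h integral_scaleR_right using W1 integrable_mult_osc(1)[OF W1]
    by (subst Bochner_Integration.integral_diff) simp_all
  ultimately have "(\<lambda>n. real (Suc n) *\<^sub>R (h ((1 / real (Suc n)) *\<^sub>R e) - h (0 *\<^sub>R e)))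
      \<longlonglongrightarrow> (LINT \<xi>|lborel. 2 * pi * \<i> * (of_real (e \<bullet> \<xi>) * W \<xi>))" by simp
  from LIMSEQ_unique[OF this LIMSEQ_difference_quotient[OF D]]
  show "2 * pi * \<i> * (LINT \<xi>|lborel. of_real (e \<bullet> \<xi>) * W \<xi>) = D" by simp
qed

section \<open>The Wigner distribution\<close>

text \<open>The integrability conjuncts and the nonzero denominator rule out default values of
  integral and division. The equality is between complex vectors because the integrals are complex;
  the continuously differentiable representative is tied to \<open>T\<close> by
  \<open>represents f T\<close>.\<close>

theorem proposition5p1:
  fixes T :: "'d::finite distr" and f :: "real^'d \<Rightarrow> complex"
    and \<epsilon> :: real and t :: "real^'d"
  assumes "\<epsilon> > 0"
    and "T \<in> sobolev (real CARD('d) / 2 + 1 + \<epsilon>)"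
    and "represents f T" and "C1 f"
    and "f t \<noteq> 0"
  shows "integrable lborel (wigner f t) \<and>
    (\<forall>j. integrable lborel (\<lambda>\<xi>. complex_of_real (\<xi> $ j) * wigner f t \<xi>)) \<and>
    (LINT \<xi>|lborel. wigner f t \<xi>) \<noteq> 0 \<and>
    (\<chi> j. complex_of_real (((1 / (2 * pi)) *\<^sub>R grad_arg f t) $ j)) =
      (\<chi> j. (LINT \<xi>|lborel. complex_of_real (\<xi> $ j) * wigner f t \<xi>)
            / (LINT \<xi>|lborel. wigner f t \<xi>))"
proof -
  obtain g where g_meas: "g \<in> L2_loc" and g_rep: "represents g (fourier_distr T)"
    and g_int: "integrable lborel (\<lambda>\<xi>. bracket \<xi> powr (2 * (real CARD('d) / 2 + 1 + \<epsilon>)) * (norm (g \<xi>))\<^sup>2)"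
    using assms(2) unfolding sobolev_def by blast
  have [measurable]: "g \<in> borel_measurable borel" using g_meas by (simp add: L2_loc_def)
  have s: "real CARD('d) / 2 + 1 + \<epsilon> > real CARD('d) / 2 + 1" using assms(1) by simp
  have gw: "integrable lborel (\<lambda>\<xi>. (1 + norm \<xi>) * norm (g \<xi>))"
    and g2: "integrable lborel (\<lambda>\<xi>. (norm (g \<xi>))\<^sup>2)"
    using sobolev_integrable_weighted[OF _ s g_int] sobolev_integrable_square[OF _ s g_int] by simp_all
  have g1: "integrable lborel g"
    by (rule Bochner_Integration.integrable_bound[OF gw]) (auto simp: algebra_simps)
  have diff: "f differentiable (at x)" for x using assms(4) by (simp add: C1_def)
  have cont: "continuous_on UNIV f"
    by (simp add: diff continuous_at_imp_continuous_on differentiable_imp_continuous_within)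
  have [measurable]: "f \<in> borel_measurable borel" by (intro borel_measurable_continuous_onI cont)
  have f_eq: "f x = (LINT \<xi>|lborel. g \<xi> * osc x \<xi>)" for x
    by (rule represents_inverse_fourier[OF g_rep assms(3) cont g1])
  have f2: "integrable lborel (\<lambda>x. (norm (f x))\<^sup>2)"
    using square_integrable_inverse_fourier[OF g1 g2] by (simp add: f_eq)

  define h where "h \<tau> = f (t + \<tau> /\<^sub>R 2) * cnj (f (t - \<tau> /\<^sub>R 2))" for \<tau>
  have h_cont: "continuous_on UNIV h"
    unfolding h_def by (intro continuous_intros continuous_on_compose2[OF cont]) auto
  then have [measurable]: "h \<in> borel_measurable borel" by (rule borel_measurable_continuous_onI)
  have h_int: "integrable lborel h"
  proof (rule Bochner_Integration.integrable_bound)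
    \<comment> \<open>The product is bounded by the sum of squares; the shifts are written with
      factors 1/2 and -1/2 to fit \<open>integrable_affine\<close>.\<close>
    show "integrable lborel (\<lambda>\<tau>. (norm (f (t + (1 / 2) *\<^sub>R \<tau>)))\<^sup>2 + (norm (f (t + (- 1 / 2) *\<^sub>R \<tau>)))\<^sup>2)"
      by (intro Bochner_Integration.integrable_add integrable_affine[OF f2]) auto
    show "AE \<tau> in lborel. norm (h \<tau>) \<le> norm ((norm (f (t + (1 / 2) *\<^sub>R \<tau>)))\<^sup>2 + (norm (f (t + (- 1 / 2) *\<^sub>R \<tau>)))\<^sup>2)"
    proof (intro AE_I2)
      fix \<tau>
      let ?x = "norm (f (t + (1 / 2) *\<^sub>R \<tau>))" and ?y = "norm (f (t + (- 1 / 2) *\<^sub>R \<tau>))"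
      have "norm (h \<tau>) = ?x * ?y" by (simp add: h_def norm_mult)
      also have "\<dots> \<le> ?x\<^sup>2 + ?y\<^sup>2"
        using sum_squares_bound[of ?x ?y] mult_nonneg_nonneg[OF norm_ge_zero norm_ge_zero, of "f (t + (1 / 2) *\<^sub>R \<tau>)" "f (t + (- 1 / 2) *\<^sub>R \<tau>)"] by linarith
      finally show "norm (h \<tau>) \<le> norm (?x\<^sup>2 + ?y\<^sup>2)" by simp
    qed
  qed measurable

  \<comment> \<open>\<open>u\<close> absorbs the phase at the fixed point t, so that only \<tau>
    remains in the oscillations.\<close>
  define u where "u a = g a * osc t a" for a
  let ?Q = "\<lambda>p. u (fst p) * cnj (u (snd p))"
  let ?L = "\<lambda>p::(real^'d) \<times> (real^'d). (1 / 2) *\<^sub>R (fst p + snd p)"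
  have [measurable]: "u \<in> borel_measurable borel" unfolding u_def by measurable
  have u_int: "integrable lborel u" unfolding u_def by (intro integrable_mult_osc g1)
  have u_norm: "norm (u a) = norm (g a)" for a by (simp add: u_def norm_mult)
  have Q: "integrable (lborel \<Otimes>\<^sub>M lborel) ?Q"
    by (intro integrable_pair_mult integrable_cnj u_int)
  \<comment> \<open>The midpoint satisfies |a + b| / 2 \<le> (1 + |a|) (1 + |b|), so the weight
    splits over the two copies of g.\<close>
  have QL: "integrable (lborel \<Otimes>\<^sub>M lborel) (\<lambda>p. norm (?L p) * norm (?Q p))"
  proof (rule Bochner_Integration.integrable_bound[OF integrable_pair_mult[OF gw gw]])
    show "(\<lambda>p. norm (?L p) * norm (?Q p)) \<in> borel_measurable (lborel \<Otimes>\<^sub>M lborel)"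
      by (rule borel_measurable_times[OF _ borel_measurable_integrable[OF integrable_norm[OF Q]]]) measurable
    show "AE p in lborel \<Otimes>\<^sub>M lborel. norm (norm (?L p) * norm (?Q p)) \<le> norm ((1 + norm (fst p)) * norm (g (fst p)) * ((1 + norm (snd p)) * norm (g (snd p))))"
    proof (intro AE_I2)
      fix p :: "(real^'d) \<times> (real^'d)"
      let ?a = "fst p" and ?b = "snd p"
      have "norm (?L p) = norm (?a + ?b) / 2" by simp
      also have "\<dots> \<le> norm ?a + norm ?b"
        using norm_triangle_ineq[of ?a ?b] norm_ge_zero[of ?a] norm_ge_zero[of ?b] by linarith
      also have "\<dots> \<le> (1 + norm ?a) * (1 + norm ?b)" by (simp add: algebra_simps)
      finally have "norm (?L p) * (norm (g ?a) * norm (g ?b)) \<le> (1 + norm ?a) * (1 + norm ?b) * (norm (g ?a) * norm (g ?b))"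
        by (rule mult_right_mono) simp
      then show "norm (norm (?L p) * norm (?Q p)) \<le> norm ((1 + norm ?a) * norm (g ?a) * ((1 + norm ?b) * norm (g ?b)))"
        by (simp add: norm_mult u_norm mult_ac)
    qed
  qed
  have h_eq: "h \<tau> = (LINT p|(lborel \<Otimes>\<^sub>M lborel). ?Q p * osc \<tau> (?L p))" for \<tau>
  proof -
    let ?e = "osc (\<tau> /\<^sub>R 2)"
    have 1: "f (t + \<tau> /\<^sub>R 2) = (LINT a|lborel. u a * ?e a)"
      unfolding f_eq u_def osc_add_left by (simp add: mult.assoc)
    \<comment> \<open>The reflection of \<tau> and the conjugation each reverse the sign of the
      frequency, so b enters with the same sign as a and the frequencies add to (a + b) / 2.\<close>
    have "f (t - \<tau> /\<^sub>R 2) = (LINT b|lborel. u b * cnj (?e b))"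
      unfolding f_eq u_def diff_conv_add_uminus osc_add_left osc_minus_left cnj_osc by (simp add: mult.assoc)
    then have 2: "cnj (f (t - \<tau> /\<^sub>R 2)) = (LINT b|lborel. cnj (u b) * ?e b)"
      by (simp flip: Bochner_Integration.integral_cnj)
    have "h \<tau> = (LINT p|(lborel \<Otimes>\<^sub>M lborel). (u (fst p) * ?e (fst p)) * (cnj (u (snd p)) * ?e (snd p)))"
      unfolding h_def 1 2
      by (intro integral_pair_mult[symmetric] integrable_mult_osc integrable_cnj u_int)
    also have "(\<lambda>p. (u (fst p) * ?e (fst p)) * (cnj (u (snd p)) * ?e (snd p))) = (\<lambda>p. ?Q p * osc \<tau> (?L p))"
    proof
      fix p :: "(real^'d) \<times> (real^'d)"
      have "osc \<tau> (?L p) = ?e (fst p) * ?e (snd p)"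
        unfolding osc_add_right[symmetric] by (simp add: osc_def)
      then show "(u (fst p) * ?e (fst p)) * (cnj (u (snd p)) * ?e (snd p)) = ?Q p * osc \<tau> (?L p)"
        by (simp only: mult_ac)
    qed
    finally show ?thesis .
  qed

  \<comment> \<open>Integrability, inversion and total mass of the Wigner distribution\<close>
  let ?W = "wigner f t"
  have W_eq: "?W = (\<lambda>\<xi>. LINT \<tau>|lborel. h \<tau> * osc \<tau> (- \<xi>))"
    unfolding wigner_def h_def osc_eq_exp ..
  have [measurable]: "?W \<in> borel_measurable borel" unfolding W_eq by measurable
  have W_weighted: "integrable lborel (\<lambda>\<xi>. (1 + norm \<xi>) * norm (?W \<xi>))"
    unfolding W_eq
    by (rule integrable_weighted_fourier[OF sigma_finite_lborel_pair Q _ QL h_int h_eq]) measurable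
  have W_int: "integrable lborel ?W"
    by (rule Bochner_Integration.integrable_bound[OF W_weighted]) (auto simp: algebra_simps)
  have inv: "h \<tau> = (LINT \<xi>|lborel. ?W \<xi> * osc \<tau> \<xi>)" for \<tau>
    unfolding W_eq by (rule fourier_inversion[OF h_int h_cont]) (use W_int in \<open>simp add: W_eq\<close>)

  define z where "z = f t"
  define N where "N = (Re z)\<^sup>2 + (Im z)\<^sup>2"
  have N: "N \<noteq> 0" using assms(5) by (simp add: N_def z_def complex_eq_iff sum_power2_eq_zero_iff)
  have mass: "integral\<^sup>L lborel ?W = of_real N"
    using inv[of 0] by (simp add: h_def z_def N_def complex_mult_cnj)

  \<comment> \<open>The gradient of the argument and the first moments\<close>
  obtain f' where f': "(f has_derivative f') (at t)" using diff[of t] unfolding differentiable_def by blast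
  have lin: "linear (\<lambda>x. Re (f' x))" "linear (\<lambda>x. Im (f' x))"
    using has_derivative_linear[OF f']
    by (auto intro: linear_compose[unfolded o_def] bounded_linear.linear bounded_linear_Re bounded_linear_Im)
  \<comment> \<open>The adjoint of a real functional, evaluated at 1, is the vector representing it:
    the gradients of Re f and Im f.\<close>
  define du where "du = adjoint (\<lambda>x. Re (f' x)) 1"
  define dv where "dv = adjoint (\<lambda>x. Im (f' x)) 1"
  have du: "x \<bullet> du = Re (f' x)" and dv: "x \<bullet> dv = Im (f' x)" for x
    by (simp_all add: du_def dv_def adjoint_works lin)
  have "GDERIV (\<lambda>x. Re (f x)) t :> du" "GDERIV (\<lambda>x. Im (f x)) t :> dv"
    unfolding gderiv_def du dv
    by (rule bounded_linear.has_derivative[OF bounded_linear_Re f']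
        bounded_linear.has_derivative[OF bounded_linear_Im f'])+
  then have grad: "grad_arg f t = (Re z *\<^sub>R dv - Im z *\<^sub>R du) /\<^sub>R N"
    unfolding N_def z_def by (rule grad_arg_eq) fact

  have moment: "integrable lborel (\<lambda>\<xi>. complex_of_real (\<xi> $ j) * ?W \<xi>)"
    "(LINT \<xi>|lborel. complex_of_real (\<xi> $ j) * ?W \<xi>) = of_real ((Re z * dv $ j - Im z * du $ j) / (2 * pi))" for j
  proof -
    let ?e = "axis j 1 :: real^'d"
    \<comment> \<open>Product rule for f(t + s e / 2) cnj (f(t - s e / 2)) at s = 0.\<close>
    let ?D = "z * cnj (f' ((- 1 / 2) *\<^sub>R ?e)) + f' ((1 / 2) *\<^sub>R ?e) * cnj z"
    have shift: "((\<lambda>s. f (t + (c * s) *\<^sub>R ?e)) has_derivative (\<lambda>s. f' ((c * s) *\<^sub>R ?e))) (at 0)" for c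
    proof (rule has_derivative_compose[of _ _ _ _ f])
      show "((\<lambda>s. t + (c * s) *\<^sub>R ?e) has_derivative (\<lambda>s. (c * s) *\<^sub>R ?e)) (at 0)"
        by (auto intro!: derivative_eq_intros)
      show "(f has_derivative f') (at (t + (c * 0) *\<^sub>R ?e))" using f' by simp
    qed
    have scale: "f' ((c * s) *\<^sub>R ?e) = s *\<^sub>R f' (c *\<^sub>R ?e)" for c s
      using linear_scale[OF has_derivative_linear[OF f'], of s "c *\<^sub>R ?e"] by (simp add: mult.commute)
    have "((\<lambda>s. f (t + (1 / 2 * s) *\<^sub>R ?e) * cnj (f (t + (- 1 / 2 * s) *\<^sub>R ?e))) has_derivative
        (\<lambda>s. f (t + (1 / 2 * 0) *\<^sub>R ?e) * cnj (f' ((- 1 / 2 * s) *\<^sub>R ?e))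
          + f' ((1 / 2 * s) *\<^sub>R ?e) * cnj (f (t + (- 1 / 2 * 0) *\<^sub>R ?e)))) (at 0)"
      by (intro has_derivative_mult bounded_linear.has_derivative[OF bounded_linear_cnj] shift)
    then have "((\<lambda>s. h (s *\<^sub>R ?e)) has_vector_derivative ?D) (at 0)"
      unfolding has_vector_derivative_def scale
      by (simp add: h_def z_def scaleR_add_right mult.commute)
    note mom = inverse_fourier_moment[OF W_weighted _ inv this]
    show "integrable lborel (\<lambda>\<xi>. complex_of_real (\<xi> $ j) * ?W \<xi>)"
      using mom(1) by (simp add: inner_axis')
    \<comment> \<open>The opposite shifts make \<open>?D\<close> half the difference of cnj z f'(e)
      and its conjugate: the real parts cancel, and i Im (cnj z f'(e)) is left, the numerator of the
      gradient of the argument.\<close>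
    have "?D = \<i> * of_real (Re z * dv $ j - Im z * du $ j)"
    proof -
      have c: "f' (c *\<^sub>R ?e) = c *\<^sub>R f' ?e" for c
        using linear_scale[OF has_derivative_linear[OF f'], of c ?e] by simp
      have e: "f' ?e = Complex (du $ j) (dv $ j)"
        using du[of ?e] dv[of ?e] by (simp add: inner_axis' complex_eq_iff)
      show ?thesis unfolding c e by (simp add: complex_eq_iff field_simps)
    qed
    with mom(2) have "\<i> * (of_real (2 * pi) * (LINT \<xi>|lborel. complex_of_real (\<xi> $ j) * ?W \<xi>)) = \<i> * of_real (Re z * dv $ j - Im z * du $ j)"
      by (simp add: inner_axis' mult_ac)
    then have "of_real (2 * pi) * (LINT \<xi>|lborel. complex_of_real (\<xi> $ j) * ?W \<xi>) = of_real (Re z * dv $ j - Im z * du $ j)"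
      by (rule mult_left_cancel[THEN iffD1, rotated]) simp
    then show "(LINT \<xi>|lborel. complex_of_real (\<xi> $ j) * ?W \<xi>) = of_real ((Re z * dv $ j - Im z * du $ j) / (2 * pi))"
      by (simp add: field_simps)
  qed
  have "((1 / (2 * pi)) *\<^sub>R grad_arg f t) $ j = (Re z * dv $ j - Im z * du $ j) / (2 * pi) / N" for j
    unfolding grad vector_scaleR_component vector_minus_component real_scaleR_def divide_inverse
    by (simp only: mult_ac mult_1_left mult_1_right inverse_mult_distrib)
  then have "complex_of_real (((1 / (2 * pi)) *\<^sub>R grad_arg f t) $ j) =
      (LINT \<xi>|lborel. complex_of_real (\<xi> $ j) * ?W \<xi>) / integral\<^sup>L lborel ?W" for j
    by (simp only: moment(2) mass of_real_divide)
  moreover have "integral\<^sup>L lborel ?W \<noteq> 0"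
    unfolding mass using N by (simp only: of_real_eq_0_iff not_False_eq_True)
  ultimately show ?thesis
    using W_int moment(1) by (intro conjI allI arg_cong[where f = vec_lambda] ext) assumption+
qed

end
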